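(* Let $d\in\mathbb{N}$ and $1<p\le 2$. Then for any $g\in L^p([0,1]^d)$ (and any $m\in\mathbb{N}$), $$\Vert g-G_m^p(g,\mathcal{H})\Vert_p\le\left(2+\frac{1}{\left(1-\left(\frac12\right)^{d/p}\right)^2}\right)\left(\left(2^d-1\right)\left(\max\left(p,\frac{p}{p-1}\right)-1\right)\right)^2\sigma_m(g)_p .$$
   Context: Multivariate Haar basis: let $\varphi=\chi_{[0,1)}$, $\Psi_{0,0}(x)=\varphi(2x)-\varphi(2x-1)$, $\Psi^0=\varphi$, $\Psi^1=\Psi_{0,0}$. Let $E=\{0,1\}^d\setminus\{0\}$ be the set of nonzero vertices of $[0,1]^d$. For $e\in E$ put $\Psi^e(x_1,\dots,x_d)=\Psi^{e_1}(x_1)\cdots\Psi^{e_d}(x_d)$ and $\Psi^e_{j,k}(x)=2^{kd/2}\Psi^e(2^kx-j)$ for $k\ge0$, $j\in\{0,1,\dots,2^k-1\}^d$. Let $\Psi^*(x)=1$ on $[0,1]^d$. The functions $\Psi^*$ and $\Psi^e_{j,k}$ ($e\in E$, $k\ge 0$, $j\in\{0,\dots,2^k-1\}^d$) form the Haar basis, written $\mathcal{H}=\{H_I\}_{I\in\mathcal{D}}$. Here each index $I\in\mathcal{D}$ labels exactly one basis function, and $I$ also denotes the dyadic cube supporting that function. For $f\in L^p([0,1]^d)$ put $c_I(f):=(f,H_I)=\int_{[0,1]^d}f(x)H_I(x)\,dx$, and let $\Vert\cdot\Vert_p$ be the norm of $L^p([0,1]^d)$. Greedy algorithm: $\Lambda_m=\Lambda_m(f,p)$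 denotes a set of $m$ indices in $\mathcal{D}$ such that $\min_{I\in\Lambda_m}\Vert c_I(f)H_I\Vert_p\ge\max_{J\notin\Lambda_m}\Vert c_J(f)H_J\Vert_p$, and $G_m^p(f,\mathcal{H}):=\sum_{I\in\Lambda_m}c_I(f)H_I$. $\sigma_m(g)_p$ is the error of best $m$-term approximation of $g$ from $\mathcal{H}$ in $L^p([0,1]^d)$: the infimum of $\Vert g-\sum_{I\in\Lambda}a_IH_I\Vert_p$ over all sets $\Lambda\subset\mathcal{D}$ with $|\Lambda|=m$ and all scalars $a_I$. *)

theory Defs
  imports "HOL-Analysis.Analysis"
begin

text \<open>
  The dimension \<open>d\<close> is \<open>CARD('d)\<close>. Functions on the unit cube are total functions on
  \<open>real ^ 'd\<close>; norms and coefficients only see their values on the cube.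
\<close>

definition unit_cube :: "(real ^ 'd) set" where
  "unit_cube = cbox 0 1"

definition Lp_space :: "real \<Rightarrow> (real ^ 'd \<Rightarrow> real) set" where
  "Lp_space p = {f. f \<in> borel_measurable (lebesgue_on unit_cube) \<and>
                    integrable (lebesgue_on unit_cube) (\<lambda>x. \<bar>f x\<bar> powr p)}"

definition Lp_norm :: "real \<Rightarrow> (real ^ 'd \<Rightarrow> real) \<Rightarrow> real" where
  "Lp_norm p f = (integral\<^sup>L (lebesgue_on unit_cube) (\<lambda>x. \<bar>f x\<bar> powr p)) powr (1 / p)"

definition haar_phi :: "real \<Rightarrow> real" where
  "haar_phi = indicat_real {0..<1}"

definition haar_psi :: "real \<Rightarrow> real" where
  "haar_psi t = haar_phi (2 * t) - haar_phi (2 * t - 1)"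

definition haar_vertices :: "(nat ^ 'd) set" where
  "haar_vertices = {e. \<forall>i. e $ i \<in> {0, 1}} - {0}"

definition haar_Psi :: "nat ^ 'd \<Rightarrow> real ^ 'd \<Rightarrow> real" where
  "haar_Psi e x = (\<Prod>i\<in>UNIV. (if e $ i = 0 then haar_phi else haar_psi) (x $ i))"

text \<open>
  \<open>Wavelet e k j\<close> labels the function with vertex \<open>e\<close>, level \<open>k\<close> and translation \<open>j\<close>.
  For each dyadic cube there are several indices, one for each \<open>e\<close>.
\<close>

datatype 'd haar_index = Star | Wavelet "nat ^ 'd" nat "nat ^ 'd"

definition haar_indices :: "'d::finite haar_index set" where
  "haar_indices = insert Star
     {Wavelet e k j | e k j. e \<in> haar_vertices \<and> (\<forall>i. j $ i \<in> {0..<2 ^ k})}"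

fun haar :: "'d::finite haar_index \<Rightarrow> real ^ 'd \<Rightarrow> real" where
  "haar Star x = indicat_real unit_cube x"
| "haar (Wavelet e k j) x =
     2 powr (real k * real CARD('d) / 2) * haar_Psi e (2 ^ k *\<^sub>R x - (\<chi> i. real (j $ i)))"

definition haar_coeff :: "(real ^ 'd \<Rightarrow> real) \<Rightarrow> 'd::finite haar_index \<Rightarrow> real" where
  "haar_coeff f I = integral\<^sup>L (lebesgue_on unit_cube) (\<lambda>x. f x * haar I x)"

text \<open>
  \<open>\<Lambda>\<close> is an admissible choice of \<open>\<Lambda>\<^sub>m(f, p)\<close>; it need not be unique because of ties.
  The inequality between the minimum over \<open>\<Lambda>\<close> and the maximum over its complement is
  spelled out pairwise.
\<close>

definition greedy_set ::
    "real \<Rightarrow> (real ^ 'd \<Rightarrow> real) \<Rightarrow> nat \<Rightarrow> 'd::finite haar_index set \<Rightarrow> bool" where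
  "greedy_set p f m \<Lambda> \<longleftrightarrow>
     \<Lambda> \<subseteq> haar_indices \<and> finite \<Lambda> \<and> card \<Lambda> = m \<and>
     (\<forall>I\<in>\<Lambda>. \<forall>J\<in>haar_indices - \<Lambda>.
        Lp_norm p (\<lambda>x. haar_coeff f I * haar I x) \<ge> Lp_norm p (\<lambda>x. haar_coeff f J * haar J x))"

definition greedy_sum ::
    "(real ^ 'd \<Rightarrow> real) \<Rightarrow> 'd::finite haar_index set \<Rightarrow> real ^ 'd \<Rightarrow> real" where
  "greedy_sum f \<Lambda> x = (\<Sum>I\<in>\<Lambda>. haar_coeff f I * haar I x)"

definition best_m_term :: "real \<Rightarrow> nat \<Rightarrow> (real ^ 'd::finite \<Rightarrow> real) \<Rightarrow> real" where
  "best_m_term p m g =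
     Inf {Lp_norm p (\<lambda>x. g x - (\<Sum>I\<in>\<Lambda>. a I * haar I x)) | \<Lambda> a.
            \<Lambda> \<subseteq> haar_indices \<and> finite \<Lambda> \<and> card \<Lambda> = m}"

end

theory Submission imports Defs begin

text \<open>
  Write \<open>\<mu> = 2 ^ d - 1\<close>, \<open>C = \<mu> / (p - 1)\<close> and \<open>K = 1 / (1 - (1/2) powr (d / p))\<close>. For a fixed vertex \<open>e\<close> the
  function \<open>\<Psi>\<^sup>e\<close> splits every dyadic cube into two halves of equal measure, so a sign change of the
  coefficients of the \<open>\<Psi>\<^sup>e\<close> is a martingale transform, and Burkholder's function
  \<open>(q \<bar>y\<bar> - \<bar>x\<bar>) (\<bar>x\<bar> + \<bar>y\<bar>) powr q\<close> with \<open>q = p - 1\<close> bounds it by \<open>1 / (p - 1)\<close>. Summing over \<open>e\<close>,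
  every finite multiplier with entries in \<open>{-1, 0, 1}\<close> has norm at most \<open>C\<close>.

  Let \<open>f = g - h\<close> with \<open>h\<close> supported on an \<open>m\<close>-element set \<open>P\<close>. Then \<open>g - G\<^sub>m(g)\<close> is
  \<open>f\<close> minus its partial sum over \<open>P \<union> \<Lambda>\<close> (norm at most \<open>(1 + C) \<parallel>f\<parallel>\<close>) plus the part of \<open>g\<close> over
  \<open>P - \<Lambda>\<close>. Pointwise, the terms of the latter are dominated by geometric series in the level; averaging
  the coefficients of \<open>f\<close> over \<open>\<Lambda> - P\<close> over all signs bounds \<open>card (P - \<Lambda>)\<close> from above, so this part has
  norm at most \<open>2 \<mu> K C \<parallel>f\<parallel>\<close>. Finally \<open>1 + C + 2 \<mu> K C \<le> (2 + K\<^sup>2) C\<^sup>2\<close>.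
\<close>

section \<open>Burkholder's function\<close>

text \<open>Integrate \<open>g\<close> between \<open>t\<close> and \<open>s\<close> and compare it
  with the constant \<open>g t\<close>. The finite set \<open>S\<close> admits the kinks that
  absolute values cause; at a kink, monotonicity makes the value of \<open>g\<close> a
  supergradient.\<close>

lemma antimono_derivative_supergradient:
  fixes f g :: "real \<Rightarrow> real"
  assumes "finite S" and cont: "continuous_on UNIV f"
    and der: "\<And>x. x \<notin> S \<Longrightarrow> (f has_real_derivative g x) (at x)"
    and anti: "antimono g"
  shows "f s \<le> f t + g t * (s - t)"
proof -
  have I: "(g has_integral (f v - f u)) {u..v}" if "u \<le> v" for u v
    by (rule fundamental_theorem_of_calculus_interior_strong[OF \<open>finite S\<close> that])
      (auto simp: has_real_derivative_iff_has_vector_derivative[symmetric]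
        intro: der continuous_on_subset[OF cont])
  consider "t \<le> s" | "s \<le> t" by linarith
  then show ?thesis
  proof cases
    case 1
    have "f s - f t \<le> g t * (s - t)"
      by (rule has_integral_le[OF I[OF 1]])
        (use has_integral_const_real[of "g t" t s] 1 antimonoD[OF anti] in \<open>auto simp: mult.commute\<close>)
    then show ?thesis by simp
  next
    case 2
    have "g t * (t - s) \<le> f t - f s"
      by (rule has_integral_le[OF _ I[OF 2]])
        (use has_integral_const_real[of "g t" s t] 2 antimonoD[OF anti] in \<open>auto simp: mult.commute\<close>)
    then show ?thesis by (simp add: algebra_simps)
  qed
qed

lemma DERIV_abs: "x \<noteq> 0 \<Longrightarrow> (abs has_real_derivative sgn x) (at (x::real))"
proof -
  assume "x \<noteq> 0"
  then consider "x \<in> {0<..}" | "x \<in> {..<0}" by fastforce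
  then show ?thesis
  proof cases
    case 1
    then show ?thesis
      using has_field_derivative_transform_within_open[OF DERIV_ident open_greaterThan 1, of abs] by simp
  next
    case 2
    have "((\<lambda>x. - x) has_real_derivative - 1) (at x)" by (auto intro!: derivative_eq_intros)
    then show ?thesis
      using has_field_derivative_transform_within_open[OF _ open_lessThan 2, of "\<lambda>x. - x" "- 1" abs] 2 by simp
  qed
qed

text \<open>Burkholder's special function for the exponent \<open>p = 1 + q\<close> without its
  positive constant factor, which reappears in \<open>burkholder_majorant\<close>.\<close>

definition burkholder :: "real \<Rightarrow> real \<Rightarrow> real \<Rightarrow> real" where
  "burkholder q x y = (q * \<bar>y\<bar> - \<bar>x\<bar>) * (\<bar>x\<bar> + \<bar>y\<bar>) powr q"

text \<open>The difference \<open>G\<close> of the two sides vanishes at \<open>b = a\<close>. Its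
  derivative \<open>G'\<close> is nonnegative for \<open>b > a\<close> and nonpositive for
  \<open>b < a\<close>, because the weighted mean lies between \<open>a\<close> and \<open>b\<close>
  and the exponent \<open>q - 1\<close> is not positive. For \<open>a = 0\<close> the claim reduces
  to \<open>(1 + q) powr q \<le> 1 + q\<close>.\<close>

lemma powr_tangent_at_weighted_mean:
  fixes a b q :: real
  assumes q: "0 < q" "q \<le> 1" and ab: "0 \<le> a" "0 \<le> b"
  shows "b powr (1 + q) - a powr (1 + q) \<le> (1 + q) * (b - a) * ((q * a + b) / (1 + q)) powr q"
proof (cases "a = 0")
  case True
  have "b powr (1 + q) * (1 + q) powr q \<le> b powr (1 + q) * (1 + q) powr 1"
    using q by (intro mult_left_mono powr_mono) auto
  moreover have "b powr (1 + q) = b * b powr q"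
    using ab by (cases "b = 0") (auto simp: powr_add)
  ultimately show ?thesis
    using True q ab by (simp add: powr_divide field_simps)
next
  case False
  then have a: "a > 0" using ab by simp
  define p where "p = 1 + q"
  have p: "p > 1" using q by (simp add: p_def)
  define G where "G b = p * (b - a) * ((q * a + b) / p) powr q - b powr p + a powr p" for b
  define G' where "G' b = p * b * (((q * a + b) / p) powr (q - 1) - b powr (q - 1))" for b
  have cont: "continuous_on {0..} G"
    unfolding G_def using a q p
    by (intro continuous_intros continuous_on_powr') (auto simp: add_nonneg_eq_0_iff)
  have der: "(G has_real_derivative G' b) (at b)" if b: "b > 0" for b
  proof -
    define m where "m = (q * a + b) / p"
    have m: "m > 0" using a b q p by (simp add: m_def add_pos_pos)
    have 1: "(G has_real_derivative
       (p * m powr q + p * (b - a) * (q * m powr (q - 1) * (1 / p)) - p * b powr (p - 1))) (at b)"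
      unfolding G_def m_def using a b q p m[unfolded m_def]
      by (auto intro!: derivative_eq_intros simp: add_pos_pos)
    have 2: "m powr q = m * m powr (q - 1)" "b powr (p - 1) = b * b powr (q - 1)"
      using m b by (auto simp: powr_diff p_def)
    have 3: "p * m = q * a + b" using p by (simp add: m_def)
    have "p * m powr q + p * (b - a) * (q * m powr (q - 1) * (1 / p)) - p * b powr (p - 1)
      = m powr (q - 1) * (p * m + (b - a) * q) - p * (b * b powr (q - 1))"
      unfolding 2 using p by (simp add: field_simps)
    also have "\<dots> = G' b"
      unfolding 3 G'_def m_def[symmetric] by (simp add: p_def algebra_simps)
    finally show ?thesis using 1 by simp
  qed
  have Ga: "G a = 0" using q by (simp add: G_def p_def)
  have "0 \<le> G b"
  proof (cases "a \<le> b")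
    case True
    have "G a \<le> G b"
    proof (rule DERIV_nonneg_imp_increasing_open[OF True])
      show "\<exists>y. (G has_real_derivative y) (at x) \<and> 0 \<le> y" if x: "a < x" "x < b" for x
      proof (intro exI conjI)
        have "q * a \<le> q * x" using x q by simp
        then have "(q * a + x) / p \<le> x" using p q x a by (simp add: divide_le_eq p_def algebra_simps)
        then have "x powr (q - 1) \<le> ((q * a + x) / p) powr (q - 1)"
          using x a q p by (intro powr_mono2') (auto intro!: divide_pos_pos add_pos_pos)
        then show "0 \<le> G' x" using x a p by (simp add: G'_def)
      qed (use x a der in auto)
    qed (rule continuous_on_subset[OF cont], use a in auto)
    then show ?thesis using Ga by simp
  next
    case False
    then have ba: "b \<le> a" by simp
    have "G a \<le> G b"
    proof (rule DERIV_nonpos_imp_decreasing_open[OF ba])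
      show "\<exists>y. (G has_real_derivative y) (at x) \<and> y \<le> 0" if x: "b < x" "x < a" for x
      proof (intro exI conjI)
        have "q * x \<le> q * a" using x q by simp
        then have "x \<le> (q * a + x) / p" using p q x a by (simp add: le_divide_eq p_def algebra_simps)
        then have "((q * a + x) / p) powr (q - 1) \<le> x powr (q - 1)"
          using x ab q p by (intro powr_mono2') auto
        then show "G' x \<le> 0" using x ab p by (simp add: G'_def mult_nonneg_nonpos)
      qed (use x ab der in auto)
    qed (rule continuous_on_subset[OF cont], use ab in auto)
    then show ?thesis using Ga by simp
  qed
  then show ?thesis by (simp add: G_def p_def)
qed

text \<open>With \<open>a = \<bar>x\<bar> / q\<close> and \<open>b = \<bar>y\<bar>\<close> the
  weighted mean is \<open>(\<bar>x\<bar> + \<bar>y\<bar>) / (1 + q)\<close>, so the tangent bound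
  there is a multiple of \<open>burkholder q x y\<close>.\<close>

lemma burkholder_majorant:
  assumes q: "0 < q" "q \<le> 1"
  shows "\<bar>y\<bar> powr (1 + q) - (\<bar>x\<bar> / q) powr (1 + q)
    \<le> (1 + q) powr (1 - q) / q * burkholder q x y"
proof -
  have "\<bar>y\<bar> powr (1 + q) - (\<bar>x\<bar> / q) powr (1 + q)
    \<le> (1 + q) * (\<bar>y\<bar> - \<bar>x\<bar> / q) * ((\<bar>x\<bar> + \<bar>y\<bar>) / (1 + q)) powr q"
    using powr_tangent_at_weighted_mean[OF q, of "\<bar>x\<bar> / q" "\<bar>y\<bar>"] q by simp
  also have "\<dots> = (1 + q) powr (1 - q) / q * burkholder q x y"
    using q by (simp add: burkholder_def powr_divide powr_diff field_simps)
  finally show ?thesis .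
qed

section \<open>Concavity of Burkholder's function along lines of slope 0, 1 and -1\<close>

lemma continuous_burkholder:
  assumes "0 < q" "continuous_on S f" "continuous_on S g"
  shows "continuous_on S (\<lambda>t. burkholder q (f t) (g t))"
  unfolding burkholder_def using assms
  by (intro continuous_intros continuous_on_powr') auto

text \<open>The derivative in \<open>x\<close> is
  \<open>- sgn x * k (\<bar>x\<bar> + \<bar>y\<bar>)\<close>. On positive arguments \<open>k\<close>
  is nondecreasing, and it is nonnegative from \<open>\<bar>y\<bar>\<close> on, so the derivative
  decreases also across the kink at 0.\<close>

lemma burkholder_horizontal:
  assumes q: "0 < q" "q \<le> 1"
  shows "\<exists>s. \<forall>x. burkholder q x y \<le> burkholder q x0 y + s * (x - x0)"
proof -
  define k where "k v = (1 + q) * (v powr q - q * \<bar>y\<bar> * v powr (q - 1))" for v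
  define g where "g x = - sgn x * k (\<bar>x\<bar> + \<bar>y\<bar>)" for x
  have k_mono: "k v \<le> k w" if "0 < v" "v \<le> w" for v w
    unfolding k_def using that q
    by (intro mult_left_mono diff_mono powr_mono2 powr_mono2' mult_left_mono) auto
  have k_pos: "0 \<le> k v" if "v > 0" "\<bar>y\<bar> \<le> v" for v
  proof -
    have "q * \<bar>y\<bar> \<le> 1 * v" using q that by (intro mult_mono) auto
    then have "q * \<bar>y\<bar> * v powr (q - 1) \<le> 1 * v * v powr (q - 1)"
      by (intro mult_right_mono) auto
    also have "\<dots> = v powr q" using that by (simp add: powr_diff)
    finally show ?thesis unfolding k_def using q by simp
  qed
  have anti: "antimono g"
  proof (rule antimonoI)
    fix u v :: real assume "u \<le> v"
    then consider "u = v" | "0 < u" "u \<le> v" | "v < 0" "u \<le> v" | "u \<le> 0" "0 \<le> v" by linarith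
    then show "g v \<le> g u"
    proof cases
      case 2 then show ?thesis using k_mono[of "u + \<bar>y\<bar>" "v + \<bar>y\<bar>"] by (simp add: g_def)
    next
      case 3 then show ?thesis using k_mono[of "- v + \<bar>y\<bar>" "- u + \<bar>y\<bar>"] by (simp add: g_def)
    next
      case 4
      have "g v \<le> 0"
        using 4 k_pos[of "v + \<bar>y\<bar>"] by (cases "v = 0") (auto simp: g_def)
      moreover have "0 \<le> g u"
        using 4 k_pos[of "- u + \<bar>y\<bar>"] by (cases "u = 0") (auto simp: g_def sgn_if)
      ultimately show ?thesis by simp
    qed auto
  qed
  have der: "((\<lambda>x. burkholder q x y) has_real_derivative g x) (at x)" if "x \<noteq> 0" for x
  proof -
    define v where "v = \<bar>x\<bar> + \<bar>y\<bar>"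
    have v: "v > 0" using that by (simp add: v_def add_pos_nonneg)
    have "((\<lambda>x. burkholder q x y) has_real_derivative
       (- sgn x * v powr q + (q * \<bar>y\<bar> - \<bar>x\<bar>) * (q * v powr (q - 1) * sgn x))) (at x)"
      unfolding burkholder_def v_def using v[unfolded v_def]
      by (auto intro!: DERIV_abs[OF that] derivative_eq_intros)
    moreover have "v powr q = v * v powr (q - 1)" using v by (simp add: powr_diff)
    then have "- sgn x * v powr q + (q * \<bar>y\<bar> - \<bar>x\<bar>) * (q * v powr (q - 1) * sgn x) = g x"
      unfolding g_def k_def v_def[symmetric] by (simp add: v_def algebra_simps)
    ultimately show ?thesis by simp
  qed
  show ?thesis
    using antimono_derivative_supergradient[of "{0}" "\<lambda>x. burkholder q x y" g _ x0] anti der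
      continuous_burkholder[of q UNIV "\<lambda>x. x" "\<lambda>x. y"] q by auto
qed

text \<open>The derivative is \<open>(1 - q) * q * x powr (q - 2) * (x - a)\<close>. Up to the
  factor \<open>1 + q\<close>, the expression at \<open>- 2 * x - a\<close> is the slope of
  Burkholder's function on the branch \<open>x < - a\<close> of the line
  \<open>y = x + a\<close>.\<close>

lemma powr_combination_mono:
  fixes a q v w :: real
  assumes q: "0 < q" "q \<le> 1" and "0 \<le> a" "a \<le> v" "0 < v" "v \<le> w"
  shows "(1 - q) * v powr q + q * a * v powr (q - 1) \<le> (1 - q) * w powr q + q * a * w powr (q - 1)"
proof (rule DERIV_nonneg_imp_nondecreasing[OF \<open>v \<le> w\<close>], intro exI conjI)
  fix x assume x: "v \<le> x" "x \<le> w"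
  then have "x > 0" using assms by simp
  then show "((\<lambda>x. (1 - q) * x powr q + q * a * x powr (q - 1)) has_real_derivative
      (1 - q) * (q * x powr (q - 1)) + q * a * ((q - 1) * x powr (q - 1 - 1))) (at x)"
    by (auto intro!: derivative_eq_intros)
  have "x powr (q - 1) = x * x powr (q - 1 - 1)" using \<open>x > 0\<close> by (simp add: powr_mult_base)
  then have "(1 - q) * (q * x powr (q - 1)) + q * a * ((q - 1) * x powr (q - 1 - 1))
    = (1 - q) * q * x powr (q - 1 - 1) * (x - a)" by (simp add: algebra_simps)
  also have "\<dots> \<ge> 0" using q x assms by simp
  finally show "0 \<le> (1 - q) * (q * x powr (q - 1)) + q * a * ((q - 1) * x powr (q - 1 - 1))" .
qed

text \<open>Along the line \<open>y = x + a\<close> the sum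
  \<open>\<bar>x\<bar> + \<bar>x + a\<bar>\<close> has three branches. It is constant for
  \<open>- a \<le> x \<le> 0\<close>, so the function is affine there with slope
  \<open>(1 + q) * a powr q\<close>. The bounds \<open>- r w \<le> a powr q \<le> l w\<close> for
  \<open>w \<ge> a\<close> order the slopes of different branches; monotonicity of \<open>r\<close>
  and \<open>l\<close> orders them within a branch.\<close>

lemma burkholder_diagonal_nonneg:
  assumes q: "0 < q" "q \<le> 1" and a: "0 \<le> a"
  shows "\<exists>s. \<forall>x. burkholder q x (x + a) \<le> burkholder q x0 (x0 + a) + s * (x - x0)"
proof -
  define r where "r w = (1 - q) * w powr q - q * a * w powr (q - 1)" for w
  define l where "l w = (1 - q) * w powr q + q * a * w powr (q - 1)" for w
  define g where "g x = (1 + q) * (if x > 0 then - r (2 * x + a)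
     else if - a \<le> x then a powr q else l (- 2 * x - a))" for x
  have r_mono: "r v \<le> r w" if "0 < v" "v \<le> w" for v w
    unfolding r_def using that q a
    by (intro diff_mono powr_mono2 powr_mono2' mult_left_mono) auto
  have l_mono: "l v \<le> l w" if "a \<le> v" "0 < v" "v \<le> w" for v w
    unfolding l_def using powr_combination_mono q a that by blast
  have r_bound: "- r w \<le> a powr q" if "w > 0" "a \<le> w" for w
  proof (cases "a = 0")
    case True then show ?thesis using q that by (simp add: r_def)
  next
    case False
    then have "- r w \<le> - r a" using r_mono[of a w] a that by simp
    also have "- r a = (2 * q - 1) * a powr q" using False a by (simp add: r_def powr_diff algebra_simps)
    also have "\<dots> \<le> 1 * a powr q" using q by (intro mult_right_mono) auto
    finally show ?thesis by simp
  qed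
  have l_bound: "a powr q \<le> l w" if "w > 0" "a \<le> w" for w
  proof (cases "a = 0")
    case True then show ?thesis using q that by (simp add: l_def)
  next
    case False
    then have "l a = a powr q" using a by (simp add: l_def powr_diff algebra_simps)
    then show ?thesis using l_mono[of a w] a that False by simp
  qed
  have anti: "antimono g"
  proof (rule antimonoI)
    fix u v :: real assume uv: "u \<le> v"
    then consider "0 < u" | "u \<le> 0" "0 < v" "- a \<le> u" | "u < - a" "0 < v" 
      | "v \<le> 0" "- a \<le> u" | "u < - a" "- a \<le> v" "v \<le> 0" | "v < - a" by linarith
    then have "g v / (1 + q) \<le> g u / (1 + q)"
    proof cases
      case 1 then show ?thesis using r_mono[of "2 * u + a" "2 * v + a"] uv a q by (simp add: g_def)
    next
      case 2 then show ?thesis using r_bound[of "2 * v + a"] a q by (simp add: g_def)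
    next
      case 3 then show ?thesis using r_bound[of "2 * v + a"] l_bound[of "- 2 * u - a"] a q
        by (simp add: g_def)
    next
      case 4 then show ?thesis using uv a q by (simp add: g_def)
    next
      case 5 then show ?thesis using l_bound[of "- 2 * u - a"] a q by (simp add: g_def)
    next
      case 6 then show ?thesis using l_mono[of "- 2 * v - a" "- 2 * u - a"] uv a q by (simp add: g_def)
    qed
    then show "g v \<le> g u" using q by (simp add: divide_le_cancel)
  qed
  have der: "((\<lambda>x. burkholder q x (x + a)) has_real_derivative g x) (at x)" if "x \<notin> {0, - a}" for x
  proof -
    define w where "w = \<bar>x\<bar> + \<bar>x + a\<bar>"
    have w: "w > 0" using that by (simp add: w_def add_pos_nonneg)
    have nz: "x \<noteq> 0" "x + a \<noteq> 0" using that by auto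
    note A = DERIV_abs[OF nz(1)] DERIV_chain2[of abs "sgn (x + a)" "\<lambda>t. t + a", OF DERIV_abs[OF nz(2)]]
    have D: "((\<lambda>x. burkholder q x (x + a)) has_real_derivative
       ((q * sgn (x + a) - sgn x) * w powr q
         + (q * \<bar>x + a\<bar> - \<bar>x\<bar>) * (q * w powr (q - 1) * (sgn x + sgn (x + a))))) (at x)"
      unfolding burkholder_def w_def using w[unfolded w_def]
      by (auto intro!: A derivative_eq_intros)
    have W: "w powr q = w * w powr (q - 1)" using w by (simp add: powr_diff)
    consider "0 < x" | "- a < x" "x < 0" | "x < - a" using nz by linarith
    then have "(q * sgn (x + a) - sgn x) * w powr q
         + (q * \<bar>x + a\<bar> - \<bar>x\<bar>) * (q * w powr (q - 1) * (sgn x + sgn (x + a))) = g x"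
    proof cases
      case 1
      then have "2 * x + a = w" using a by (simp add: w_def)
      then have "g x = (1 + q) * - ((1 - q) * (w * w powr (q - 1)) - q * a * w powr (q - 1))"
        using 1 by (simp add: g_def r_def W)
      then show ?thesis using 1 a unfolding W by (simp add: w_def sgn_if) (simp add: algebra_simps)
    next
      case 2
      then have "w = a" by (simp add: w_def)
      then show ?thesis using 2 by (simp add: g_def sgn_if algebra_simps)
    next
      case 3
      then have "- 2 * x - a = w" using a by (simp add: w_def)
      then have "g x = (1 + q) * ((1 - q) * (w * w powr (q - 1)) + q * a * w powr (q - 1))"
        using 3 a by (simp add: g_def l_def W)
      then show ?thesis using 3 a unfolding W by (simp add: w_def sgn_if) (simp add: algebra_simps)
    qed
    with D show ?thesis by simp
  qed
  have "continuous_on UNIV (\<lambda>x. burkholder q x (x + a))"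
    using q by (intro continuous_burkholder continuous_intros)
  then show ?thesis
    using antimono_derivative_supergradient[of "{0, - a}" "\<lambda>x. burkholder q x (x + a)" g _ x0] anti der
    by auto
qed

lemma burkholder_minus: "burkholder q (- x) y = burkholder q x y" "burkholder q x (- y) = burkholder q x y"
  by (auto simp: burkholder_def)

text \<open>The slope of the supergradient cancels between \<open>x + h\<close> and
  \<open>x - h\<close>. If \<open>x > y\<close>, passing to \<open>(- x, - y)\<close> leads back to
  a nonnegative offset, since the function is even in both variables.\<close>

lemma burkholder_diagonal_midpoint:
  assumes q: "0 < q" "q \<le> 1"
  shows "burkholder q (x + h) (y + h) + burkholder q (x - h) (y - h) \<le> 2 * burkholder q x y"
proof -
  have *: "burkholder q (x + h) (y + h) + burkholder q (x - h) (y - h) \<le> 2 * burkholder q x y"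
    if "x \<le> y" for x y h
  proof -
    obtain s where s: "\<And>t. burkholder q t (t + (y - x)) \<le> burkholder q x (x + (y - x)) + s * (t - x)"
      using burkholder_diagonal_nonneg[OF q, of "y - x" x] \<open>x \<le> y\<close> by auto
    show ?thesis using s[of "x + h"] s[of "x - h"] by (simp add: algebra_simps)
  qed
  show ?thesis
  proof (cases "x \<le> y")
    case False
    then have "burkholder q (- x - h) (- y - h) + burkholder q (- x + h) (- y + h) \<le> 2 * burkholder q (- x) (- y)"
      using *[of "- x" "- y" "- h"] by simp
    then show ?thesis
      using burkholder_minus[of q "x + h"] burkholder_minus[of q "x - h"] burkholder_minus[of q x]
      by (metis add.commute minus_add_distrib minus_diff_eq uminus_add_conv_diff burkholder_minus diff_minus_eq_add)
  qed (rule *)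
qed

text \<open>Zigzag concavity: \<open>e = 1\<close> is the diagonal direction, \<open>e = 0\<close>
  the horizontal one, and \<open>e = -1\<close> becomes diagonal after reflecting
  \<open>y\<close>.\<close>

lemma burkholder_midpoint:
  assumes q: "0 < q" "q \<le> 1" and e: "e \<in> {-1, 0, 1}"
  shows "burkholder q (x + h) (y + e * h) + burkholder q (x - h) (y - e * h) \<le> 2 * burkholder q x y"
proof -
  consider "e = 1" | "e = -1" | "e = 0" using e by auto
  then show ?thesis
  proof cases
    case 1 then show ?thesis using burkholder_diagonal_midpoint[OF q] by simp
  next
    case 2
    then show ?thesis using burkholder_diagonal_midpoint[OF q, of x h "- y"]
        burkholder_minus(2)[of q _ "y - h"] burkholder_minus(2)[of q _ "y + h"] 
      by (simp add: burkholder_minus)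
  next
    case 3
    obtain s where s: "\<And>t. burkholder q t y \<le> burkholder q x y + s * (t - x)"
      using burkholder_horizontal[OF q] by blast
    show ?thesis using s[of "x + h"] s[of "x - h"] 3 by (simp add: algebra_simps)
  qed
qed

text \<open>Jensen's inequality from the supergradient at the mean. The second argument is fixed
  because the transform is constant on each half of the children.\<close>

lemma burkholder_jensen:
  assumes q: "0 < q" "q \<le> 1" and "finite J" "J \<noteq> {}"
  shows "(\<Sum>j\<in>J. burkholder q (a j) y) \<le> real (card J) * burkholder q ((\<Sum>j\<in>J. a j) / real (card J)) y"
proof -
  define x0 where "x0 = (\<Sum>j\<in>J. a j) / real (card J)"
  have c: "card J > 0" using assms by (simp add: card_gt_0_iff)
  obtain s where s: "\<And>t. burkholder q t y \<le> burkholder q x0 y + s * (t - x0)"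
    using burkholder_horizontal[OF q] by blast
  have "(\<Sum>j\<in>J. burkholder q (a j) y) \<le> (\<Sum>j\<in>J. burkholder q x0 y + s * (a j - x0))"
    by (intro sum_mono s)
  also have "\<dots> = real (card J) * burkholder q x0 y + s * ((\<Sum>j\<in>J. a j) - real (card J) * x0)"
    by (simp add: sum.distrib sum_distrib_left[symmetric] sum_subtractf)
  also have "(\<Sum>j\<in>J. a j) - real (card J) * x0 = 0" using c by (simp add: x0_def)
  finally show ?thesis by (simp add: x0_def)
qed

text \<open>The signs \<open>w\<close> cut \<open>J\<close> into two halves of equal size, on which
  \<open>a\<close> has the means \<open>x + h\<close> and \<open>x - h\<close>. Jensen's inequality
  removes the fluctuation of \<open>a\<close> inside each half, and midpoint concavity joins the
  halves. Thus a split into \<open>2 ^ d\<close> children is handled although only one sign pattern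
  is transformed.\<close>

lemma burkholder_split_step:
  fixes a w :: "'a \<Rightarrow> real"
  assumes q: "0 < q" "q \<le> 1" and e: "e \<in> {-1, 0, 1}"
    and J: "finite J" "J \<noteq> {}" and w: "\<And>j. j \<in> J \<Longrightarrow> w j = 1 \<or> w j = -1" and w0: "(\<Sum>j\<in>J. w j) = 0"
  shows "(\<Sum>j\<in>J. burkholder q (a j) (y + e * ((\<Sum>j\<in>J. w j * a j) / card J) * w j))
    \<le> card J * burkholder q ((\<Sum>j\<in>J. a j) / card J) y"
proof -
  define x where "x = (\<Sum>j\<in>J. a j) / card J"
  define h where "h = (\<Sum>j\<in>J. w j * a j) / card J"
  define P where "P = {j\<in>J. w j = 1}"
  define N where "N = {j\<in>J. w j = -1}"
  have fin: "finite P" "finite N" and dis: "P \<inter> N = {}" and un: "J = P \<union> N"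
    using J w by (auto simp: P_def N_def)
  have split: "(\<Sum>j\<in>J. f j) = (\<Sum>j\<in>P. f j) + (\<Sum>j\<in>N. f j)" for f :: "'a \<Rightarrow> real"
    unfolding un by (rule sum.union_disjoint[OF fin dis])
  have "(\<Sum>j\<in>P. w j) = card P" "(\<Sum>j\<in>N. w j) = - real (card N)"
    by (simp_all add: P_def N_def)
  then have PN: "card P = card N" using w0 split[of w] by simp
  have c: "card J = 2 * card P" unfolding un using card_Un_disjoint[OF fin dis] PN by simp
  then have cP: "card P > 0" using card_gt_0_iff[of J] J by simp
  have wa: "(\<Sum>j\<in>J. w j * a j) = (\<Sum>j\<in>P. a j) - (\<Sum>j\<in>N. a j)"
  proof -
    have "(\<Sum>j\<in>P. w j * a j) = (\<Sum>j\<in>P. a j)" "(\<Sum>j\<in>N. w j * a j) = (\<Sum>j\<in>N. - a j)"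
      by (intro sum.cong; simp add: P_def N_def)+
    then show ?thesis unfolding split by (simp add: sum_negf)
  qed
  have xh: "(\<Sum>j\<in>P. a j) / card P = x + h" "(\<Sum>j\<in>N. a j) / card N = x - h"
    using cP PN unfolding x_def h_def wa c split[of a] by (simp_all add: field_simps)
  have "(\<Sum>j\<in>J. burkholder q (a j) (y + e * h * w j))
    = (\<Sum>j\<in>P. burkholder q (a j) (y + e * h)) + (\<Sum>j\<in>N. burkholder q (a j) (y - e * h))"
    unfolding split by (intro arg_cong2[where f = "(+)"] sum.cong; simp add: P_def N_def)
  also have "\<dots> \<le> card P * burkholder q (x + h) (y + e * h) + card P * burkholder q (x - h) (y - e * h)"
    using burkholder_jensen[OF q fin(1), of a "y + e * h"] burkholder_jensen[OF q fin(2), of a "y - e * h"]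
      cP PN xh by (intro add_mono) fastforce+
  also have "\<dots> = card P * (burkholder q (x + h) (y + e * h) + burkholder q (x - h) (y - e * h))"
    by (simp add: algebra_simps)
  also have "\<dots> \<le> card P * (2 * burkholder q x y)"
    by (intro mult_left_mono burkholder_midpoint[OF q e]) auto
  finally show ?thesis by (simp add: c x_def h_def)
qed

section \<open>The dyadic grid\<close>

lemma vec_Pi_eq_image: "{v :: 'a ^ 'd::finite. \<forall>i. v $ i \<in> S i} = vec_lambda ` (PiE UNIV S)"
proof (intro equalityI subsetI)
  fix v :: "'a ^ 'd" assume "v \<in> {v. \<forall>i. v $ i \<in> S i}"
  then show "v \<in> vec_lambda ` (PiE UNIV S)"
    by (intro image_eqI[of _ _ "vec_nth v"]) auto
qed auto

lemma finite_vec_Pi: "(\<And>i. finite (S i)) \<Longrightarrow> finite {v :: 'a ^ 'd::finite. \<forall>i. v $ i \<in> S i}"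
  unfolding vec_Pi_eq_image by (intro finite_imageI finite_PiE) auto

lemma card_vec_Pi: "card {v :: 'a ^ 'd::finite. \<forall>i. v $ i \<in> S i} = (\<Prod>i\<in>UNIV. card (S i))"
  unfolding vec_Pi_eq_image
  by (subst card_image) (auto simp: card_PiE inj_on_def vec_lambda_inject)

definition grid :: "nat \<Rightarrow> (nat ^ 'd) set" where
  "grid n = {j. \<forall>i. j $ i < 2 ^ n}"

definition parent :: "nat ^ 'd \<Rightarrow> nat ^ 'd" where
  "parent j = (\<chi> i. j $ i div 2)"

definition children :: "nat ^ 'd \<Rightarrow> (nat ^ 'd) set" where
  "children j = {j'. parent j' = j}"

lemma children_eq: "children j = {j'. \<forall>i. j' $ i \<in> {2 * j $ i, 2 * j $ i + 1}}"
proof -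
  have "m div 2 = k \<longleftrightarrow> m = 2 * k \<or> m = 2 * k + 1" for m k :: nat by auto
  then show ?thesis by (simp add: children_def parent_def vec_eq_iff)
qed

lemma finite_children: "finite (children (j :: nat ^ 'd::finite))"
  unfolding children_eq by (rule finite_vec_Pi) auto

lemma card_children: "card (children (j :: nat ^ 'd::finite)) = 2 ^ CARD('d)"
  unfolding children_eq card_vec_Pi by (simp add: card_insert_if numeral_2_eq_2)

lemma children_nonempty: "children (j :: nat ^ 'd::finite) \<noteq> {}"
  using card_children[of j] by fastforce

lemma finite_grid: "finite (grid n :: (nat ^ 'd::finite) set)"
  using finite_vec_Pi[of "\<lambda>i. {..<2 ^ n :: nat}"] by (simp add: grid_def)

lemma grid_0: "grid 0 = {0}"
  by (auto simp: grid_def vec_eq_iff)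

lemma parent_mem_grid_iff: "parent j \<in> grid n \<longleftrightarrow> j \<in> grid (Suc n)"
  by (auto simp: grid_def parent_def less_mult_imp_div_less div_less_iff_less_mult mult.commute)

lemma sum_grid_Suc:
  "(\<Sum>j\<in>grid (Suc n). f j) = (\<Sum>j\<in>grid n. \<Sum>j'\<in>children (j :: nat ^ 'd::finite). f j' :: real)"
proof -
  have "(\<Sum>j\<in>grid n. sum f {x \<in> grid (Suc n). parent x = j}) = sum f (grid (Suc n) :: (nat ^ 'd) set)"
    by (rule sum.group) (auto simp: finite_grid parent_mem_grid_iff)
  moreover have "{x \<in> grid (Suc n). parent x = j} = children j" if "j \<in> grid n" for j :: "nat ^ 'd"
    using that by (auto simp: children_def parent_mem_grid_iff[symmetric])
  ultimately show ?thesis by simp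
qed

section \<open>Walsh signs on the children of a cube\<close>

text \<open>The sign of the wavelet with vertex \<open>e\<close> on the child cell labelled
  \<open>j\<close>; an odd label means the right half in that coordinate.\<close>

definition walsh :: "nat ^ 'd \<Rightarrow> nat ^ 'd::finite \<Rightarrow> real" where
  "walsh e j = (\<Prod>i\<in>UNIV. if e $ i \<noteq> 0 \<and> odd (j $ i) then -1 else 1)"

lemma walsh_cases: "walsh e j = 1 \<or> walsh e j = -1"
proof -
  have "(\<Prod>i\<in>A. if e $ i \<noteq> 0 \<and> odd (j $ i) then -1 else 1) \<in> {1, -1 :: real}" if "finite A" for A
    using that by induction auto
  then show ?thesis by (simp add: walsh_def)
qed

lemma abs_walsh: "\<bar>walsh e j\<bar> = 1" and walsh_square: "walsh e j * walsh e j = 1"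
  using walsh_cases[of e j] by auto

lemma walsh_zero: "walsh 0 j = 1"
  by (simp add: walsh_def)

text \<open>Exactly one of the two vertices involves direction \<open>i\<close>. Exchanging the two
  halves in that direction permutes the children and flips the sign of exactly one factor.\<close>

lemma walsh_orthogonal:
  fixes e e' :: "nat ^ 'd::finite"
  assumes i: "(e $ i = 0) \<noteq> (e' $ i = 0)"
  shows "(\<Sum>j'\<in>children j. walsh e j' * walsh e' j') = 0"
proof -
  \<comment> \<open>The labels \<open>2 * j $ i\<close> and \<open>2 * j $ i + 1\<close> add up to
    \<open>4 * j $ i + 1\<close>, so the subtraction swaps them.\<close>
  define flip where "flip j' = (\<chi> l. if l = i then 4 * j $ i + 1 - j' $ i else j' $ l)" for j' :: "nat ^ 'd"
  have bound: "j' $ i = 2 * j $ i \<or> j' $ i = 2 * j $ i + 1" if "j' \<in> children j" for j'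
    using that by (simp add: children_eq)
  have flip_mem: "flip j' \<in> children j" if "j' \<in> children j" for j'
  proof -
    have "4 * j $ i + 1 - j' $ i = 2 * j $ i \<or> 4 * j $ i + 1 - j' $ i = 2 * j $ i + 1"
      using bound[OF that] by auto
    then show ?thesis using that by (auto simp: children_eq flip_def)
  qed
  have flip_flip: "flip (flip j') = j'" if "j' \<in> children j" for j'
    using bound[OF that] by (auto simp: flip_def vec_eq_iff)
  have flip_walsh: "walsh u (flip j') = (if u $ i = 0 then 1 else -1) * walsh u j'"
    if "j' \<in> children j" for u j'
  proof -
    have "j' $ i \<in> {2 * j $ i, 2 * j $ i + 1}" using that by (simp add: children_eq)
    then have odd: "odd (flip j' $ i) \<longleftrightarrow> even (j' $ i)" by (auto simp: flip_def)
    have "(\<Prod>l\<in>UNIV - {i}. if u $ l \<noteq> 0 \<and> odd (flip j' $ l) then -1 else 1 :: real)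
        = (\<Prod>l\<in>UNIV - {i}. if u $ l \<noteq> 0 \<and> odd (j' $ l) then -1 else 1)"
      by (intro prod.cong) (auto simp: flip_def)
    then show ?thesis
      unfolding walsh_def by (subst (1 2) prod.remove[of UNIV i]) (auto simp: odd)
  qed
  have "(\<Sum>j'\<in>children j. walsh e j' * walsh e' j') = (\<Sum>j'\<in>children j. - (walsh e j' * walsh e' j'))"
  proof (rule sum.reindex_bij_witness[of _ flip flip])
    fix j' assume j': "j' \<in> children j"
    show "- (walsh e (flip j') * walsh e' (flip j')) = walsh e j' * walsh e' j'"
      unfolding flip_walsh[OF j'] using i by auto
  qed (use flip_mem flip_flip in auto)
  then show ?thesis by (simp add: sum_negf)
qed

lemma sum_walsh:
  fixes e :: "nat ^ 'd::finite"
  assumes "e \<noteq> 0"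
  shows "(\<Sum>j'\<in>children j. walsh e j') = 0"
proof -
  obtain i where "e $ i \<noteq> 0" using assms by (auto simp: vec_eq_iff)
  then show ?thesis using walsh_orthogonal[of e i 0 j] by (simp add: walsh_zero)
qed

section \<open>Dyadic martingales and their transforms\<close>

definition martingale :: "(nat \<Rightarrow> nat ^ 'd::finite \<Rightarrow> real) \<Rightarrow> bool" where
  "martingale A \<longleftrightarrow> (\<forall>k. \<forall>j\<in>grid k. (\<Sum>j'\<in>children j. A (Suc k) j') = 2 ^ CARD('d) * A k j)"

text \<open>The amplitude of \<open>walsh e\<close> in the martingale increment from the cube
  \<open>j\<close> to its children.\<close>

definition walsh_coeff :: "(nat \<Rightarrow> nat ^ 'd::finite \<Rightarrow> real) \<Rightarrow> nat ^ 'd \<Rightarrow> nat \<Rightarrow> nat ^ 'd \<Rightarrow> real" where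
  "walsh_coeff A e k j = (\<Sum>j'\<in>children j. walsh e j' * A (Suc k) j') / 2 ^ CARD('d)"

text \<open>The martingale transform that keeps the increments of a single vertex \<open>e\<close>.
  Multiplier and coefficient are read at the parent, which makes it predictable. The separate
  initial factor \<open>s\<close> lets the constant term enter only one of the transforms.\<close>

primrec transform :: "real \<Rightarrow> (nat \<Rightarrow> nat ^ 'd \<Rightarrow> real) \<Rightarrow> (nat \<Rightarrow> nat ^ 'd::finite \<Rightarrow> real) \<Rightarrow> nat ^ 'd
    \<Rightarrow> nat \<Rightarrow> nat ^ 'd \<Rightarrow> real" where
  "transform s \<theta> A e 0 j = s * A 0 j"
| "transform s \<theta> A e (Suc k) j = transform s \<theta> A e k (parent j)
     + \<theta> k (parent j) * walsh_coeff A e k (parent j) * walsh e j"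

text \<open>By \<open>burkholder_split_step\<close> in each cube, the sum at level
  \<open>Suc n\<close> is at most \<open>2 ^ d\<close> times the sum at level \<open>n\<close>,
  which preserves nonpositivity. At level 0 the value is nonpositive because
  \<open>\<bar>s\<bar> \<le> 1\<close> and \<open>q \<le> 1\<close>.\<close>

lemma burkholder_transform_nonpos:
  fixes e :: "nat ^ 'd::finite"
  assumes q: "0 < q" "q \<le> 1" and A: "martingale A" and "e \<noteq> 0"
    and s: "s \<in> {-1, 0, 1}" and \<theta>: "\<And>k j. \<theta> k j \<in> {-1, 0, 1}"
  shows "(\<Sum>j\<in>grid n. burkholder q (A n j) (transform s \<theta> A e n j)) \<le> 0"
proof (induction n)
  case 0
  have "\<bar>s * A 0 0\<bar> \<le> \<bar>A 0 0\<bar>" using s by auto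
  then have "q * \<bar>s * A 0 0\<bar> \<le> 1 * \<bar>A 0 0\<bar>" using q by (intro mult_mono) auto
  then show ?case by (simp add: grid_0 burkholder_def mult_nonpos_nonneg)
next
  case (Suc n)
  have "(\<Sum>j'\<in>children j. burkholder q (A (Suc n) j') (transform s \<theta> A e (Suc n) j'))
      \<le> 2 ^ CARD('d) * burkholder q (A n j) (transform s \<theta> A e n j)" if "j \<in> grid n" for j
  proof -
    have "(\<Sum>j'\<in>children j. A (Suc n) j') / card (children j) = A n j"
      using A that by (simp add: martingale_def card_children)
    moreover have "transform s \<theta> A e (Suc n) j' = transform s \<theta> A e n j + \<theta> n j *
        ((\<Sum>j'\<in>children j. walsh e j' * A (Suc n) j') / card (children j)) * walsh e j'"
      if "j' \<in> children j" for j'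
      using that by (simp add: children_def card_children[unfolded children_def] walsh_coeff_def)
    moreover have "(\<Sum>j'\<in>children j. burkholder q (A (Suc n) j') (transform s \<theta> A e n j + \<theta> n j *
        ((\<Sum>j'\<in>children j. walsh e j' * A (Suc n) j') / card (children j)) * walsh e j'))
      \<le> card (children j) * burkholder q ((\<Sum>j'\<in>children j. A (Suc n) j') / card (children j))
          (transform s \<theta> A e n j)"
      by (rule burkholder_split_step[OF q \<theta> finite_children children_nonempty walsh_cases sum_walsh[OF \<open>e \<noteq> 0\<close>]])
    ultimately show ?thesis by (simp add: card_children)
  qed
  then have "(\<Sum>j\<in>grid (Suc n). burkholder q (A (Suc n) j) (transform s \<theta> A e (Suc n) j))
    \<le> (\<Sum>j\<in>grid n. 2 ^ CARD('d) * burkholder q (A n j) (transform s \<theta> A e n j))"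
    unfolding sum_grid_Suc by (rule sum_mono)
  also have "\<dots> \<le> 0" using Suc by (simp add: sum_distrib_left[symmetric] mult_nonneg_nonpos)
  finally show ?case .
qed

lemma transform_powr_bound:
  fixes e :: "nat ^ 'd::finite"
  assumes p: "1 < p" "p \<le> 2" and A: "martingale A" and "e \<noteq> 0"
    and s: "s \<in> {-1, 0, 1}" and \<theta>: "\<And>k j. \<theta> k j \<in> {-1, 0, 1}"
  shows "(\<Sum>j\<in>grid n. \<bar>transform s \<theta> A e n j\<bar> powr p)
    \<le> (1 / (p - 1)) powr p * (\<Sum>j\<in>grid n. \<bar>A n j\<bar> powr p)"
proof -
  define q where "q = p - 1"
  have q: "0 < q" "q \<le> 1" and pq: "p = 1 + q" using p by (auto simp: q_def)
  have "(\<Sum>j\<in>grid n. \<bar>transform s \<theta> A e n j\<bar> powr p - (\<bar>A n j\<bar> / q) powr p)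
    \<le> (\<Sum>j\<in>grid n. p powr (1 - q) / q * burkholder q (A n j) (transform s \<theta> A e n j))"
    unfolding pq by (intro sum_mono burkholder_majorant[OF q])
  also have "\<dots> \<le> 0"
    unfolding sum_distrib_left[symmetric] using q burkholder_transform_nonpos[OF q A \<open>e \<noteq> 0\<close> s \<theta>]
    by (intro mult_nonneg_nonpos) auto
  finally show ?thesis
    using q by (simp add: sum_subtractf sum_distrib_left powr_divide q_def[symmetric])
qed

section \<open>Dyadic cells and averages\<close>

abbreviation Q :: "(real ^ 'd::finite) measure" where
  "Q \<equiv> lebesgue_on unit_cube"

definition cell :: "nat \<Rightarrow> nat ^ 'd \<Rightarrow> (real ^ 'd) set" where
  "cell n j = {x. \<forall>i. real (j $ i) \<le> 2 ^ n * x $ i \<and> 2 ^ n * x $ i < real (j $ i) + 1}"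

text \<open>Every point of the half-open cube lies in exactly one of its cells of each level. It
  differs from \<open>unit_cube\<close> by a null set, so identities valid on it may be integrated
  over \<open>unit_cube\<close>.\<close>

abbreviation hcube :: "(real ^ 'd) set" where
  "hcube \<equiv> cell 0 0"

text \<open>On \<open>hcube\<close> the coordinates are nonnegative, so \<open>nat\<close> loses
  nothing.\<close>

definition cell_index :: "nat \<Rightarrow> real ^ 'd \<Rightarrow> nat ^ 'd" where
  "cell_index n x = (\<chi> i. nat \<lfloor>2 ^ n * x $ i\<rfloor>)"

lemma hcube_iff: "x \<in> hcube \<longleftrightarrow> (\<forall>i. 0 \<le> x $ i \<and> x $ i < 1)"
  by (simp add: cell_def)

lemma hcube_subset_unit_cube: "hcube \<subseteq> unit_cube"
  by (auto simp: hcube_iff unit_cube_def mem_box_cart less_imp_le)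

lemma cell_index_mem_grid: "x \<in> hcube \<Longrightarrow> cell_index n x \<in> grid n"
proof -
  assume x: "x \<in> hcube"
  have "nat \<lfloor>2 ^ n * x $ i\<rfloor> < 2 ^ n" for i
  proof -
    have "\<lfloor>2 ^ n * x $ i\<rfloor> < 2 ^ n"
      using x by (simp add: floor_less_iff hcube_iff)
    then show ?thesis by (simp add: nat_less_iff)
  qed
  then show ?thesis by (simp add: grid_def cell_index_def)
qed

lemma floor_eq_nat_iff:
  fixes y :: real
  assumes "0 \<le> y"
  shows "nat \<lfloor>y\<rfloor> = m \<longleftrightarrow> real m \<le> y \<and> y < real m + 1"
proof -
  have "nat \<lfloor>y\<rfloor> = m \<longleftrightarrow> \<lfloor>y\<rfloor> = int m" using assms by (auto simp: nat_eq_iff)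
  also have "\<dots> \<longleftrightarrow> real m \<le> y \<and> y < real m + 1" by (simp add: floor_eq_iff)
  finally show ?thesis .
qed

lemma mem_cell_iff: "x \<in> hcube \<Longrightarrow> x \<in> cell n j \<longleftrightarrow> cell_index n x = j"
  by (auto simp: cell_def cell_index_def vec_eq_iff floor_eq_nat_iff)

lemma cell_subset_hcube: "j \<in> grid n \<Longrightarrow> cell n j \<subseteq> hcube"
proof
  fix x assume j: "j \<in> grid n" and x: "x \<in> cell n j"
  have "0 \<le> x $ i \<and> x $ i < 1" for i
  proof -
    have 1: "real (j $ i) \<le> 2 ^ n * x $ i" "2 ^ n * x $ i < real (j $ i) + 1"
      using x by (auto simp: cell_def)
    have "j $ i + 1 \<le> 2 ^ n" using j by (simp add: grid_def Suc_le_eq)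
    then have "real (j $ i) + 1 \<le> 2 ^ n" 
      using of_nat_mono[of "j $ i + 1" "2 ^ n", where 'a = real] by simp
    then have "2 ^ n * x $ i < 2 ^ n * 1" using 1 by linarith
    then have "x $ i < 1" by (rule mult_left_less_imp_less) simp
    have "2 ^ n * 0 \<le> 2 ^ n * x $ i" using 1 of_nat_0_le_iff[of "j $ i"] by linarith
    then have "0 \<le> x $ i" by (rule mult_left_le_imp_le) simp
    with \<open>x $ i < 1\<close> show ?thesis by simp
  qed
  then show "x \<in> hcube" by (simp add: hcube_iff)
qed

lemma parent_cell_index: "x \<in> hcube \<Longrightarrow> parent (cell_index (Suc n) x) = cell_index n x"
proof -
  assume x: "x \<in> hcube"
  have "nat \<lfloor>2 ^ Suc n * x $ i\<rfloor> div 2 = nat \<lfloor>2 ^ n * x $ i\<rfloor>" for i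
  proof -
    have "0 \<le> x $ i" using x by (simp add: hcube_iff)
    moreover define m where "m = nat \<lfloor>2 ^ Suc n * x $ i\<rfloor>"
    ultimately have "real m \<le> 2 ^ Suc n * x $ i" "2 ^ Suc n * x $ i < real m + 1"
      using floor_eq_nat_iff[of "2 ^ Suc n * x $ i" m] by auto
    moreover have "real m = 2 * real (m div 2) + real (m mod 2)"
      by (metis mult_div_mod_eq of_nat_add of_nat_mult of_nat_numeral)
    moreover have "real (m mod 2) \<le> 1" by simp
    ultimately have "real (m div 2) \<le> 2 ^ n * x $ i" "2 ^ n * x $ i < real (m div 2) + 1"
      by (auto simp: algebra_simps)
    then show ?thesis
      using floor_eq_nat_iff[of "2 ^ n * x $ i" "m div 2"] \<open>0 \<le> x $ i\<close> by (simp add: m_def)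
  qed
  then show ?thesis by (simp add: parent_def cell_index_def)
qed

section \<open>Haar functions in terms of cell labels\<close>

text \<open>On the interval of length one starting at \<open>j\<close>, the floor of
  \<open>2 * y\<close> is \<open>2 * j\<close> in the left half and \<open>2 * j + 1\<close> in the
  right half, so its parity decides the sign.\<close>

lemma haar_psi_floor:
  fixes y :: real
  assumes "0 \<le> y"
  shows "haar_phi (y - real j) = (if nat \<lfloor>y\<rfloor> = j then 1 else 0)"
    and "haar_psi (y - real j) = (if nat \<lfloor>y\<rfloor> = j then if odd (nat \<lfloor>2 * y\<rfloor>) then -1 else 1 else 0)"
proof -
  show "haar_phi (y - real j) = (if nat \<lfloor>y\<rfloor> = j then 1 else 0)"
    using floor_eq_nat_iff[OF assms, of j] by (auto simp: haar_phi_def indicator_def)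
  show "haar_psi (y - real j) = (if nat \<lfloor>y\<rfloor> = j then if odd (nat \<lfloor>2 * y\<rfloor>) then -1 else 1 else 0)"
  proof -
    consider "y < j" | "j \<le> y" "y < j + 1 / 2" | "j + 1 / 2 \<le> y" "y < j + 1" | "j + 1 \<le> y" by linarith
    then show ?thesis
    proof cases
      case 2
      then have "nat \<lfloor>2 * y\<rfloor> = 2 * j" using assms by (subst floor_eq_nat_iff) auto
      moreover have "nat \<lfloor>y\<rfloor> = j" using 2 assms by (subst floor_eq_nat_iff) auto
      ultimately show ?thesis using 2 by (simp add: haar_psi_def haar_phi_def indicator_def)
    next
      case 3
      then have "nat \<lfloor>2 * y\<rfloor> = 2 * j + 1" using assms by (subst floor_eq_nat_iff) auto
      moreover have "nat \<lfloor>y\<rfloor> = j" using 3 assms by (subst floor_eq_nat_iff) auto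
      ultimately show ?thesis using 3 by (simp add: haar_psi_def haar_phi_def indicator_def)
    next
      case 1
      then have "nat \<lfloor>y\<rfloor> \<noteq> j" using assms by (subst floor_eq_nat_iff) auto
      then show ?thesis using 1 by (simp add: haar_psi_def haar_phi_def indicator_def)
    next
      case 4
      then have "nat \<lfloor>y\<rfloor> \<noteq> j" using assms by (subst floor_eq_nat_iff) auto
      then show ?thesis using 4 by (simp add: haar_psi_def haar_phi_def indicator_def)
    qed
  qed
qed

text \<open>By \<open>haar_psi_floor\<close> in each coordinate, no factor vanishes exactly when
  \<open>j\<close> is the cell label at level \<open>k\<close>, and the parities one level deeper
  multiply to the Walsh sign.\<close>

lemma haar_Wavelet_eq:
  assumes x: "x \<in> hcube"
  shows "haar (Wavelet e k j) x = 2 powr (real k * real CARD('d) / 2)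
    * (if cell_index k x = j then walsh e (cell_index (Suc k) (x :: real ^ 'd::finite)) else 0)"
proof -
  have x0: "0 \<le> 2 ^ k * x $ i" for i using x by (simp add: hcube_iff)
  have f: "(if e $ i = 0 then haar_phi else haar_psi) (2 ^ k * x $ i - real (j $ i))
    = (if nat \<lfloor>2 ^ k * x $ i\<rfloor> = j $ i then
        if e $ i \<noteq> 0 \<and> odd (nat \<lfloor>2 ^ Suc k * x $ i\<rfloor>) then -1 else 1 else 0)" for i
    using haar_psi_floor[OF x0[of i], of "j $ i"] by (simp add: mult.assoc)
  have "haar_Psi e (2 ^ k *\<^sub>R x - (\<chi> i. real (j $ i)))
    = (if cell_index k x = j then walsh e (cell_index (Suc k) x) else 0)"
  proof (cases "cell_index k x = j")
    case True
    then have "nat \<lfloor>2 ^ k * x $ i\<rfloor> = j $ i" for i by (auto simp: cell_index_def)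
    then show ?thesis using True f by (simp add: haar_Psi_def walsh_def cell_index_def)
  next
    case False
    then obtain i where "nat \<lfloor>2 ^ k * x $ i\<rfloor> \<noteq> j $ i" by (auto simp: cell_index_def vec_eq_iff)
    then have z: "(if e $ i = 0 then haar_phi else haar_psi) ((2 ^ k *\<^sub>R x - (\<chi> i. real (j $ i))) $ i) = 0"
      using f[of i] by simp
    have "haar_Psi e (2 ^ k *\<^sub>R x - (\<chi> i. real (j $ i))) = 0"
      unfolding haar_Psi_def by (rule prod_zero, simp, rule bexI[where x = i], rule z, simp)
    then show ?thesis using False by simp
  qed
  then show ?thesis by simp
qed

lemma haar_Star_eq: "x \<in> hcube \<Longrightarrow> haar Star x = 1"
  using hcube_subset_unit_cube by auto

lemma negligible_unit_cube_diff: "negligible (unit_cube - hcube)"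
proof (rule negligible_subset)
  show "unit_cube - hcube \<subseteq> cbox 0 1 - box 0 (1 :: real ^ 'd)"
    by (auto simp: unit_cube_def hcube_iff mem_box_cart less_imp_le)
qed (rule negligible_frontier_interval)

lemma cell_lmeasurable: "cell n j \<in> lmeasurable"
  and measure_cell: "measure lebesgue (cell n j) = (1 / 2 ^ n) ^ CARD('d)"
  for j :: "nat ^ 'd::finite"
proof -
  define a b :: "real ^ 'd" where "a = (\<chi> i. real (j $ i) / 2 ^ n)" and "b = (\<chi> i. (real (j $ i) + 1) / 2 ^ n)"
  have 1: "box a b \<subseteq> cell n j" "cell n j \<subseteq> cbox a b"
    by (auto simp: a_def b_def cell_def mem_box_cart field_simps less_imp_le)
  then have "negligible (cbox a b - cell n j)"
    by (intro negligible_subset[OF negligible_frontier_interval[of a b]]) auto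
  moreover have "cell n j = cbox a b - (cbox a b - cell n j)" using 1 by auto
  ultimately show m: "cell n j \<in> lmeasurable"
    by (metis lmeasurable_cbox negligible_imp_measurable fmeasurable.Diff fmeasurableD)
  have "sym_diff (cell n j) (cbox a b) \<subseteq> cbox a b - box a b" using 1 by auto
  then have "measure lebesgue (cell n j) = measure lebesgue (cbox a b)"
    using measure_negligible_symdiff[of "cbox a b" "cell n j"] 
    by (metis (no_types, lifting) lmeasurable_cbox negligible_frontier_interval negligible_subset sup.commute)
  also have "\<dots> = (\<Prod>i\<in>(UNIV :: 'd set). 1 / 2 ^ n)"
  proof -
    have "b $ i - a $ i = 1 / 2 ^ n" "a $ i \<le> b $ i" for i
      by (simp_all add: a_def b_def diff_divide_distrib[symmetric] divide_right_mono)
    moreover from this(2) have "a \<in> cbox a b" by (simp add: mem_box_cart)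
    then have "cbox a b \<noteq> {}" by blast
    ultimately show ?thesis by (simp add: content_cbox_cart)
  qed
  finally show "measure lebesgue (cell n j) = (1 / 2 ^ n) ^ CARD('d)" by simp
qed

lemma finite_measure_Q: "finite_measure (Q :: (real ^ 'd::finite) measure)"
  by (simp add: finite_measure_lebesgue_on unit_cube_def)

lemma AE_hcube: "AE x in Q. x \<in> hcube"
  using negligible_unit_cube_diff
  by (auto simp: AE_restrict_space_iff negligible_iff_null_sets unit_cube_def Diff_eq intro!: AE_I')

lemma cell_in_sets: "j \<in> grid n \<Longrightarrow> cell n j \<in> sets Q"
  using cell_lmeasurable[of n j] cell_subset_hcube[of j n] hcube_subset_unit_cube
  by (auto simp: sets_restrict_space_iff unit_cube_def)

lemma measure_Q_cell: "j \<in> grid n \<Longrightarrow> measure Q (cell n j) = (1 / 2 ^ n) ^ CARD('d)" for j :: "nat ^ 'd::finite"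
  using cell_subset_hcube[of j n] hcube_subset_unit_cube
  by (subst measure_restrict_space) (auto simp: measure_cell unit_cube_def)

section \<open>Cell averages and Haar coefficients\<close>

text \<open>For \<open>j \<in> grid n\<close> the factor is the reciprocal of the measure of the
  cell, so these are the values of the dyadic conditional expectation of \<open>f\<close> at level
  \<open>n\<close>.\<close>

definition avg :: "(real ^ 'd \<Rightarrow> real) \<Rightarrow> nat \<Rightarrow> nat ^ 'd::finite \<Rightarrow> real" where
  "avg f n j = (2 ^ n) ^ CARD('d) * (\<integral>x. f x * indicator (cell n j) x \<partial>Q)"

lemma sum_cell_index:
  "x \<in> hcube \<Longrightarrow> (\<Sum>j\<in>grid n. F j * indicator (cell n j) x) = F (cell_index n x)" for F :: "_ \<Rightarrow> real"
  by (simp add: indicator_def mem_cell_iff if_distrib[of "(*) _"] finite_grid cell_index_mem_grid cong: if_cong)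

lemma haar_measurable [measurable]: "haar I \<in> borel_measurable Q" for I :: "'d::finite haar_index"
proof -
  have "haar I \<in> borel_measurable lebesgue"
  proof (cases I)
    case Star
    have "haar Star = indicat_real (unit_cube :: (real ^ 'd) set)" by auto
    then show ?thesis using Star by (auto simp: unit_cube_def intro!: borel_measurable_indicator)
  next
    case (Wavelet e k j)
    have [measurable]: "haar_phi \<in> borel_measurable borel" by (simp add: haar_phi_def)
    have [measurable]: "haar_psi \<in> borel_measurable borel" unfolding haar_psi_def by measurable
    have nth: "(\<lambda>x. (2 ^ k *\<^sub>R x - (\<chi> i. real (j $ i))) $ i) \<in> borel_measurable borel" for i
      by (intro borel_measurable_continuous_onI continuous_intros)
    have "(\<lambda>x. (if e $ i = 0 then haar_phi else haar_psi) ((2 ^ k *\<^sub>R x - (\<chi> i. real (j $ i))) $ i))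
        \<in> borel_measurable borel" for i
      using measurable_compose[OF nth[of i], of haar_phi borel] measurable_compose[OF nth[of i], of haar_psi borel]
      by simp
    then have "haar I \<in> borel_measurable borel"
      unfolding Wavelet haar.simps haar_Psi_def by (intro borel_measurable_times borel_measurable_prod) auto
    then show ?thesis by (intro measurable_completion) simp
  qed
  then show ?thesis by (rule measurable_restrict_space1)
qed

text \<open>Almost everywhere \<open>g\<close> is a finite combination of indicators of cells, all
  of the same measure. This reduces integrals of products of Haar functions to sums over the
  grid.\<close>

lemma has_bochner_integral_cell_index:
  fixes F :: "nat ^ 'd::finite \<Rightarrow> real"
  assumes g: "g \<in> borel_measurable Q" and gF: "\<And>x. x \<in> hcube \<Longrightarrow> g x = F (cell_index n x)"
  shows "has_bochner_integral Q g ((1 / 2 ^ n) ^ CARD('d) * (\<Sum>j\<in>grid n. F j))"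
proof -
  have cell: "has_bochner_integral Q (indicator (cell n j) :: _ \<Rightarrow> real) ((1 / 2 ^ n) ^ CARD('d))"
    if "j \<in> grid n" for j :: "nat ^ 'd"
    using has_bochner_integral_real_indicator[OF cell_in_sets[OF that]]
      finite_measure.emeasure_finite[OF finite_measure_Q, of "cell n j"] that
    by (simp add: measure_Q_cell less_top)
  have "has_bochner_integral Q (\<lambda>x. \<Sum>j\<in>grid n. F j * indicator (cell n j) x)
      (\<Sum>j\<in>grid n. F j * (1 / 2 ^ n) ^ CARD('d))"
    by (intro has_bochner_integral_sum has_bochner_integral_mult_right cell)
  moreover from this have "has_bochner_integral Q (\<lambda>x. \<Sum>j\<in>grid n. F j * indicator (cell n j) x) y
      \<longleftrightarrow> has_bochner_integral Q g y" for y
    by (intro has_bochner_integral_cong_AE g borel_measurable_has_bochner_integral)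
      (use AE_hcube in \<open>auto elim!: eventually_mono simp: sum_cell_index gF\<close>)
  ultimately show ?thesis by (simp add: sum_distrib_right mult.commute)
qed

lemma Lp_space_integrable:
  assumes "1 \<le> p" "f \<in> Lp_space p"
  shows "integrable Q f"
proof (rule Bochner_Integration.integrable_bound)
  interpret finite_measure "Q :: (real ^ 'a) measure" by (rule finite_measure_Q)
  show "integrable Q (\<lambda>x. 1 + \<bar>f x\<bar> powr p)" "f \<in> borel_measurable Q"
    using assms by (auto simp: Lp_space_def)
  have "norm (f x) \<le> norm (1 + \<bar>f x\<bar> powr p)" for x
  proof (cases "\<bar>f x\<bar> \<le> 1")
    case False
    then have "\<bar>f x\<bar> powr 1 \<le> \<bar>f x\<bar> powr p" using assms by (intro powr_mono) auto
    then show ?thesis by simp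
  qed (simp add: add_increasing2)
  then show "AE x in Q. norm (f x) \<le> norm (1 + \<bar>f x\<bar> powr p)" by simp
qed

lemma children_subset_grid: "j \<in> grid n \<Longrightarrow> children j \<subseteq> grid (Suc n)"
  by (auto simp: children_def parent_mem_grid_iff[symmetric])

lemma sum_children_indicator:
  assumes x: "x \<in> hcube"
  shows "(\<Sum>j'\<in>children j. w j' * indicator (cell (Suc k) j') x)
    = (if cell_index k x = j then w (cell_index (Suc k) (x :: real ^ 'd::finite)) else 0 :: real)"
proof -
  have "cell_index (Suc k) x \<in> children j \<longleftrightarrow> cell_index k x = j"
    using parent_cell_index[OF x] by (simp add: children_def)
  then show ?thesis
    by (simp add: indicator_def mem_cell_iff[OF x] if_distrib[of "(*) _"] finite_children cong: if_cong)
qed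

text \<open>One computation for two uses: the weight 1 gives the martingale property of the
  averages, and a multiple of the Walsh sign gives the Haar coefficients.\<close>

lemma sum_children_avg:
  fixes f :: "real ^ 'd::finite \<Rightarrow> real"
  assumes f: "integrable Q f" and j: "j \<in> grid k" and g: "g \<in> borel_measurable Q"
    and gw: "\<And>x. x \<in> hcube \<Longrightarrow> g x = (if cell_index k x = j then w (cell_index (Suc k) x) else 0)"
  shows "(\<Sum>j'\<in>children j. w j' * avg f (Suc k) j') = (2 ^ Suc k) ^ CARD('d) * (\<integral>x. f x * g x \<partial>Q)"
proof -
  have int: "integrable Q (\<lambda>x. f x * indicator (cell (Suc k) j') x)" if "j' \<in> children j" for j'
    using that children_subset_grid[OF j] by (intro integrable_real_mult_indicator f cell_in_sets) auto
  have "(\<Sum>j'\<in>children j. w j' * avg f (Suc k) j')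
    = (2 ^ Suc k) ^ CARD('d) * (\<Sum>j'\<in>children j. \<integral>x. w j' * (f x * indicator (cell (Suc k) j') x) \<partial>Q)"
    unfolding avg_def sum_distrib_left integral_mult_right_zero by (intro sum.cong) simp_all
  also have "(\<Sum>j'\<in>children j. \<integral>x. w j' * (f x * indicator (cell (Suc k) j') x) \<partial>Q)
    = (\<integral>x. (\<Sum>j'\<in>children j. w j' * (f x * indicator (cell (Suc k) j') x)) \<partial>Q)"
    by (intro Bochner_Integration.integral_sum[symmetric] integrable_mult_right int) auto
  also have "\<dots> = (\<integral>x. f x * g x \<partial>Q)"
  proof (rule integral_cong_AE)
    have "integrable Q (\<lambda>x. \<Sum>j'\<in>children j. w j' * (f x * indicator (cell (Suc k) j') x))"
      by (intro Bochner_Integration.integrable_sum integrable_mult_right int) auto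
    then show "(\<lambda>x. \<Sum>j'\<in>children j. w j' * (f x * indicator (cell (Suc k) j') x)) \<in> borel_measurable Q"
      by (rule borel_measurable_integrable)
    show "(\<lambda>x. f x * g x) \<in> borel_measurable Q"
      using borel_measurable_integrable[OF f] g by (rule borel_measurable_times)
    have "(\<Sum>j'\<in>children j. w j' * (f x * indicator (cell (Suc k) j') x)) = f x * g x" if "x \<in> hcube" for x
    proof -
      have "(\<Sum>j'\<in>children j. w j' * (f x * indicator (cell (Suc k) j') x))
        = f x * (\<Sum>j'\<in>children j. w j' * indicator (cell (Suc k) j') x)"
        by (simp add: sum_distrib_left mult_ac)
      then show ?thesis using sum_children_indicator[OF that, of w k j] gw[OF that] by simp
    qed
    then show "AE x in Q. (\<Sum>j'\<in>children j. w j' * (f x * indicator (cell (Suc k) j') x)) = f x * g x"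
      using AE_hcube by (auto elim!: eventually_mono)
  qed
  finally show ?thesis .
qed

lemma martingale_avg:
  fixes f :: "real ^ 'd::finite \<Rightarrow> real"
  assumes f: "integrable Q f"
  shows "martingale (avg f)"
  unfolding martingale_def
proof (intro allI ballI)
  fix k and j :: "nat ^ 'd" assume j: "j \<in> grid k"
  have "(\<Sum>j'\<in>children j. 1 * avg f (Suc k) j')
      = (2 ^ Suc k) ^ CARD('d) * (\<integral>x. f x * indicator (cell k j) x \<partial>Q)"
    using cell_in_sets[OF j]
    by (intro sum_children_avg f j) (auto simp: indicator_def mem_cell_iff intro!: borel_measurable_indicator)
  then show "(\<Sum>j'\<in>children j. avg f (Suc k) j') = 2 ^ CARD('d) * avg f k j"
    by (simp add: avg_def power_mult_distrib)
qed

text \<open>The square of the normalising factor is the reciprocal of the measure of the cell. Hence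
  the amplitude of a Haar term is the Walsh amplitude of the averages, which ties Haar multipliers
  to martingale transforms.\<close>

lemma haar_coeff_Wavelet:
  fixes f :: "real ^ 'd::finite \<Rightarrow> real"
  assumes f: "integrable Q f" and j: "j \<in> grid k"
  shows "haar_coeff f (Wavelet e k j) * 2 powr (real k * real CARD('d) / 2) = walsh_coeff (avg f) e k j"
proof -
  define s where "s = 2 powr (real k * real CARD('d) / 2)"
  have s2: "s * s = (2 ^ k) ^ CARD('d)"
    by (simp add: s_def powr_add[symmetric] powr_realpow[symmetric] powr_powr)
  have s0: "s > 0" by (simp add: s_def)
  have "(\<Sum>j'\<in>children j. s * walsh e j' * avg f (Suc k) j') = (2 ^ Suc k) ^ CARD('d) * haar_coeff f (Wavelet e k j)"
    unfolding haar_coeff_def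
    by (rule sum_children_avg[OF f j]) (auto simp: haar_Wavelet_eq s_def simp del: haar.simps)
  then have "s * walsh_coeff (avg f) e k j = s * s * haar_coeff f (Wavelet e k j)"
    unfolding walsh_coeff_def s2 by (simp add: sum_distrib_left[symmetric] mult.assoc power_mult_distrib)
  then show ?thesis using s0 by (simp add: s_def)
qed

lemma haar_coeff_Star: "haar_coeff f Star = avg f 0 0" if "f \<in> borel_measurable Q"
proof -
  have "0 \<in> grid 0" by (simp add: grid_0)
  note [measurable] = cell_in_sets[OF this] that
  show ?thesis
    unfolding haar_coeff_def avg_def power_0 power_one mult_1
    by (intro integral_cong_AE) (use AE_hcube in \<open>auto elim!: eventually_mono simp: haar_Star_eq simp del: haar.simps\<close>)
qed

section \<open>Convexity of the p-th power and Jensen's inequality for averages\<close>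

lemma powr_abs_tangent:
  fixes p u :: real
  assumes "1 < p"
  shows "\<bar>u\<bar> powr p + p * sgn u * \<bar>u\<bar> powr (p - 1) * (t - u) \<le> \<bar>t\<bar> powr p"
proof -
  define g where "g t = - p * sgn t * \<bar>t\<bar> powr (p - 1)" for t :: real
  have "antimono g"
  proof (rule antimonoI)
    fix x y :: real assume "x \<le> y"
    then consider "x = y" | "0 < x" "x \<le> y" | "y < 0" "x \<le> y" | "x \<le> 0" "0 \<le> y" by linarith
    then show "g y \<le> g x"
    proof cases
      case 2 then show ?thesis using assms by (simp add: g_def powr_mono2)
    next
      case 3 then show ?thesis using assms by (simp add: g_def powr_mono2)
    next
      case 4
      then have "g y \<le> 0" "0 \<le> g x" using assms by (auto simp: g_def sgn_if)
      then show ?thesis by simp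
    qed simp
  qed
  moreover have "((\<lambda>t. - (\<bar>t\<bar> powr p)) has_real_derivative g t) (at t)" if "t \<notin> {0}" for t
    using that by (auto intro!: DERIV_abs derivative_eq_intros simp: g_def)
  moreover have "continuous_on UNIV (\<lambda>t :: real. - (\<bar>t\<bar> powr p))"
    using assms by (intro continuous_intros continuous_on_powr') auto
  ultimately have "- (\<bar>t\<bar> powr p) \<le> - (\<bar>u\<bar> powr p) + g u * (t - u)"
    by (intro antimono_derivative_supergradient[of "{0}"]) auto
  then show ?thesis by (simp add: g_def algebra_simps)
qed

text \<open>In each cell, integrate the supporting line of the p-th power at the average of
  \<open>f\<close>; its linear term integrates to 0.\<close>

lemma sum_avg_powr_le:
  fixes f :: "real ^ 'd::finite \<Rightarrow> real"
  assumes p: "1 < p" and f: "f \<in> Lp_space p"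
  shows "(1 / 2 ^ n) ^ CARD('d) * (\<Sum>j\<in>grid n. \<bar>avg f n j\<bar> powr p) \<le> (\<integral>x. \<bar>f x\<bar> powr p \<partial>Q)"
proof -
  interpret finite_measure "Q :: (real ^ 'd) measure" by (rule finite_measure_Q)
  have "integrable Q f" by (rule Lp_space_integrable[OF less_imp_le[OF p] f])
  moreover have "integrable Q (\<lambda>x. \<bar>f x\<bar> powr p)" using f unfolding Lp_space_def by blast
  ultimately have int: "integrable Q f" "integrable Q (\<lambda>x. \<bar>f x\<bar> powr p)" .
  define c :: real where "c = (1 / 2 ^ n) ^ CARD('d)"
  have le: "c * \<bar>avg f n j\<bar> powr p \<le> (\<integral>x. \<bar>f x\<bar> powr p * indicator (cell n j) x \<partial>Q)" if j: "j \<in> grid n" for j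
  proof -
    define u where "u = avg f n j"
    obtain s where s: "\<And>t. \<bar>u\<bar> powr p + s * (t - u) \<le> \<bar>t\<bar> powr p"
      using powr_abs_tangent[OF p] by blast
    have ind: "integrable Q (indicator (cell n j) :: _ \<Rightarrow> real)"
      by (intro integrable_real_indicator cell_in_sets j) (simp add: less_top[symmetric])
    have mc: "measure Q (cell n j) = c" "cell n j \<inter> space Q = cell n j"
      using measure_Q_cell[OF j] cell_in_sets[OF j, THEN sets.sets_into_space] by (auto simp: c_def)
    have fi: "integrable Q (\<lambda>x. f x * indicator (cell n j) x)"
      by (intro integrable_real_mult_indicator int cell_in_sets j)
    have "c * (\<integral>x. f x * indicator (cell n j) x \<partial>Q) = c * (c * u)"
      by (simp add: u_def avg_def c_def power_one_over)
    then have u: "(\<integral>x. f x * indicator (cell n j) x \<partial>Q) = c * u" by (simp add: c_def)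
    have mi: "(\<integral>x. indicator (cell n j) x \<partial>Q) = c"
      using Bochner_Integration.integral_indicator[of Q "cell n j"] mc by simp
    have "(\<integral>x. (\<bar>u\<bar> powr p - s * u) * indicator (cell n j) x + s * (f x * indicator (cell n j) x) \<partial>Q)
      = (\<integral>x. (\<bar>u\<bar> powr p - s * u) * indicator (cell n j) x \<partial>Q) + (\<integral>x. s * (f x * indicator (cell n j) x) \<partial>Q)"
      by (intro Bochner_Integration.integral_add integrable_mult_right ind fi)
    also have "\<dots> = (\<bar>u\<bar> powr p - s * u) * c + s * (c * u)"
      unfolding integral_mult_right_zero u mi ..
    also have "\<dots> = c * \<bar>u\<bar> powr p" by (simp add: algebra_simps)
    finally have "c * \<bar>u\<bar> powr p
      = (\<integral>x. (\<bar>u\<bar> powr p - s * u) * indicator (cell n j) x + s * (f x * indicator (cell n j) x) \<partial>Q)" ..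
    also have "\<dots> \<le> (\<integral>x. \<bar>f x\<bar> powr p * indicator (cell n j) x \<partial>Q)"
    proof (rule integral_mono)
      show "integrable Q (\<lambda>x. (\<bar>u\<bar> powr p - s * u) * indicator (cell n j) x + s * (f x * indicator (cell n j) x))"
        by (intro Bochner_Integration.integrable_add integrable_mult_right ind fi)
      show "integrable Q (\<lambda>x. \<bar>f x\<bar> powr p * indicator (cell n j) x)"
        by (intro integrable_real_mult_indicator int cell_in_sets j)
      show "(\<bar>u\<bar> powr p - s * u) * indicator (cell n j) x + s * (f x * indicator (cell n j) x)
          \<le> \<bar>f x\<bar> powr p * indicator (cell n j) x" for x
        using s[of "f x"] by (simp add: indicator_def algebra_simps)
    qed
    finally show ?thesis by (simp add: u_def)
  qed
  have "c * (\<Sum>j\<in>grid n. \<bar>avg f n j\<bar> powr p) \<le> (\<Sum>j\<in>grid n. \<integral>x. \<bar>f x\<bar> powr p * indicator (cell n j) x \<partial>Q)"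
    unfolding sum_distrib_left by (intro sum_mono le)
  also have "\<dots> = (\<integral>x. (\<Sum>j\<in>grid n. \<bar>f x\<bar> powr p * indicator (cell n j) x) \<partial>Q)"
    by (intro Bochner_Integration.integral_sum[symmetric] integrable_real_mult_indicator int cell_in_sets)
  also have "\<dots> \<le> (\<integral>x. \<bar>f x\<bar> powr p \<partial>Q)"
  proof (rule integral_mono_AE)
    show "integrable Q (\<lambda>x. \<Sum>j\<in>grid n. \<bar>f x\<bar> powr p * indicator (cell n j) x)"
      by (intro Bochner_Integration.integrable_sum integrable_real_mult_indicator int cell_in_sets)
    show "AE x in Q. (\<Sum>j\<in>grid n. \<bar>f x\<bar> powr p * indicator (cell n j) x) \<le> \<bar>f x\<bar> powr p"
      using AE_hcube
    proof eventually_elim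
      case (elim x)
      show ?case using sum_cell_index[OF elim, of "\<lambda>_. \<bar>f x\<bar> powr p" n] by simp
    qed
  qed (rule int)
  finally show ?thesis by (simp add: c_def)
qed

section \<open>The space of p-integrable functions\<close>

lemma Lp_norm_nonneg [simp]: "0 \<le> Lp_norm p f"
  by (simp add: Lp_norm_def)

lemma Lp_norm_powr: "0 < p \<Longrightarrow> Lp_norm p f powr p = (\<integral>x. \<bar>f x\<bar> powr p \<partial>Q)"
  by (simp add: Lp_norm_def powr_powr)

lemma Lp_norm_le_iff:
  assumes "0 < p" "0 \<le> c"
  shows "Lp_norm p f \<le> c \<longleftrightarrow> (\<integral>x. \<bar>f x\<bar> powr p \<partial>Q) \<le> c powr p"
  using assms powr_mono2[of p "Lp_norm p f" c] powr_less_mono2[of p c "Lp_norm p f"]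
  by (auto simp: Lp_norm_powr[symmetric] not_le[symmetric])

lemma Lp_norm_cong:
  assumes "f \<in> borel_measurable Q" "g \<in> borel_measurable Q" "\<And>x. x \<in> hcube \<Longrightarrow> f x = g x"
  shows "Lp_norm p f = Lp_norm p g"
  unfolding Lp_norm_def
  by (rule arg_cong[where f = "\<lambda>t. t powr (1 / p)"], rule integral_cong_AE)
    (use assms AE_hcube in \<open>auto elim!: eventually_mono\<close>)

lemma powr_abs_convex:
  fixes a b u v :: real
  assumes "1 < p" "0 \<le> a" "0 \<le> b" "a + b = 1"
  shows "\<bar>a * u + b * v\<bar> powr p \<le> a * \<bar>u\<bar> powr p + b * \<bar>v\<bar> powr p"
proof -
  define m where "m = a * u + b * v"
  obtain s where s: "\<And>t. \<bar>m\<bar> powr p + s * (t - m) \<le> \<bar>t\<bar> powr p"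
    using powr_abs_tangent[OF \<open>1 < p\<close>] by blast
  have "a * (\<bar>m\<bar> powr p + s * (u - m)) + b * (\<bar>m\<bar> powr p + s * (v - m)) \<le> a * \<bar>u\<bar> powr p + b * \<bar>v\<bar> powr p"
    by (intro add_mono mult_left_mono s assms)
  moreover have "a * (\<bar>m\<bar> powr p + s * (u - m)) + b * (\<bar>m\<bar> powr p + s * (v - m))
    = (a + b) * \<bar>m\<bar> powr p + s * (a * u + b * v - (a + b) * m)" by (simp add: algebra_simps)
  ultimately show ?thesis using assms by (simp add: m_def)
qed

text \<open>Write \<open>f + g\<close> as \<open>a + b\<close> times a convex combination of
  \<open>f / a\<close> and \<open>g / b\<close> and use convexity pointwise. Minkowski's inequality
  follows with \<open>a\<close> and \<open>b\<close> close to the two norms.\<close>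

lemma Lp_space_add_aux:
  assumes p: "1 < p" and f: "f \<in> Lp_space p" and g: "g \<in> Lp_space p" and ab: "0 < a" "0 < b"
  shows "(\<lambda>x. f x + g x) \<in> Lp_space p"
    and "(\<integral>x. \<bar>f x + g x\<bar> powr p \<partial>Q) \<le> (a + b) powr p *
      (a / (a + b) * ((\<integral>x. \<bar>f x\<bar> powr p \<partial>Q) / a powr p) + b / (a + b) * ((\<integral>x. \<bar>g x\<bar> powr p \<partial>Q) / b powr p))"
proof -
  define h where "h x = (a + b) powr p *
      (a / (a + b) * (\<bar>f x\<bar> powr p / a powr p) + b / (a + b) * (\<bar>g x\<bar> powr p / b powr p))" for x
  have int: "integrable Q (\<lambda>x. \<bar>f x\<bar> powr p)" "integrable Q (\<lambda>x. \<bar>g x\<bar> powr p)"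
    and meas [measurable]: "f \<in> borel_measurable Q" "g \<in> borel_measurable Q"
    using f g by (auto simp: Lp_space_def)
  have h: "integrable Q h"
    unfolding h_def by (intro integrable_mult_right Bochner_Integration.integrable_add integrable_divide int)
  have le: "\<bar>f x + g x\<bar> powr p \<le> h x" for x
  proof -
    have "f x + g x = (a + b) * (a / (a + b) * (f x / a) + b / (a + b) * (g x / b))"
      using ab by (simp add: add_divide_distrib[symmetric])
    then have "\<bar>f x + g x\<bar> powr p = (a + b) powr p * \<bar>a / (a + b) * (f x / a) + b / (a + b) * (g x / b)\<bar> powr p"
      using ab by (metis abs_mult abs_of_pos add_pos_pos powr_mult)
    also have "\<dots> \<le> (a + b) powr p * (a / (a + b) * \<bar>f x / a\<bar> powr p + b / (a + b) * \<bar>g x / b\<bar> powr p)"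
      using ab by (intro mult_left_mono powr_abs_convex p) (auto simp: add_divide_distrib[symmetric])
    also have "\<dots> = h x" using ab by (simp add: h_def powr_divide)
    finally show ?thesis .
  qed
  have int2: "integrable Q (\<lambda>x. \<bar>f x + g x\<bar> powr p)"
    by (rule Bochner_Integration.integrable_bound[OF h]) (use le in \<open>auto intro: order_trans[OF le abs_ge_self]\<close>)
  then show "(\<lambda>x. f x + g x) \<in> Lp_space p" by (simp add: Lp_space_def)
  have "(\<integral>x. \<bar>f x + g x\<bar> powr p \<partial>Q) \<le> (\<integral>x. h x \<partial>Q)"
    by (intro integral_mono int2 h le)
  also have "\<dots> = (a + b) powr p *
      (a / (a + b) * ((\<integral>x. \<bar>f x\<bar> powr p \<partial>Q) / a powr p) + b / (a + b) * ((\<integral>x. \<bar>g x\<bar> powr p \<partial>Q) / b powr p))"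
    unfolding h_def integral_mult_right_zero
    by (subst Bochner_Integration.integral_add) (auto intro!: integrable_mult_right integrable_divide int)
  finally show "(\<integral>x. \<bar>f x + g x\<bar> powr p \<partial>Q) \<le> (a + b) powr p *
      (a / (a + b) * ((\<integral>x. \<bar>f x\<bar> powr p \<partial>Q) / a powr p) + b / (a + b) * ((\<integral>x. \<bar>g x\<bar> powr p \<partial>Q) / b powr p))" .
qed

lemma Lp_space_add: "1 < p \<Longrightarrow> f \<in> Lp_space p \<Longrightarrow> g \<in> Lp_space p \<Longrightarrow> (\<lambda>x. f x + g x) \<in> Lp_space p"
  using Lp_space_add_aux(1)[of p f g 1 1] by simp

lemma Lp_norm_add:
  assumes p: "1 < p" and f: "f \<in> Lp_space p" and g: "g \<in> Lp_space p"
  shows "Lp_norm p (\<lambda>x. f x + g x) \<le> Lp_norm p f + Lp_norm p g"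
proof (rule field_le_epsilon)
  fix e :: real assume e: "e > 0"
  \<comment> \<open>The added \<open>e / 2\<close> keeps both weights positive when a norm is
    0.\<close>
  define a b where "a = Lp_norm p f + e / 2" and "b = Lp_norm p g + e / 2"
  have ab: "a > 0" "b > 0" using e by (auto simp: a_def b_def add_nonneg_pos)
  have "(\<integral>x. \<bar>f x\<bar> powr p \<partial>Q) \<le> a powr p" "(\<integral>x. \<bar>g x\<bar> powr p \<partial>Q) \<le> b powr p"
    using Lp_norm_le_iff[of p a f] Lp_norm_le_iff[of p b g] p ab e by (auto simp: a_def b_def)
  then have "(\<integral>x. \<bar>f x\<bar> powr p \<partial>Q) / a powr p \<le> 1" "(\<integral>x. \<bar>g x\<bar> powr p \<partial>Q) / b powr p \<le> 1"
    using ab by (auto simp: divide_le_eq)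
  then have "a / (a + b) * ((\<integral>x. \<bar>f x\<bar> powr p \<partial>Q) / a powr p) + b / (a + b) * ((\<integral>x. \<bar>g x\<bar> powr p \<partial>Q) / b powr p)
    \<le> a / (a + b) * 1 + b / (a + b) * 1"
    using ab by (intro add_mono mult_left_mono) auto
  also have "\<dots> = 1" using ab by (simp add: add_divide_distrib[symmetric])
  finally have "(\<integral>x. \<bar>f x + g x\<bar> powr p \<partial>Q) \<le> (a + b) powr p * 1"
    by (intro order_trans[OF Lp_space_add_aux(2)[OF p f g ab]] mult_left_mono) auto
  then have "Lp_norm p (\<lambda>x. f x + g x) \<le> a + b" using p ab by (simp add: Lp_norm_le_iff)
  then show "Lp_norm p (\<lambda>x. f x + g x) \<le> Lp_norm p f + Lp_norm p g + e" by (simp add: a_def b_def)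
qed

lemma Lp_space_0: "0 < p \<Longrightarrow> (\<lambda>x. 0) \<in> Lp_space p" and Lp_norm_0: "0 < p \<Longrightarrow> Lp_norm p (\<lambda>x. 0) = 0"
  by (simp_all add: Lp_space_def Lp_norm_def)

lemma Lp_norm_sum:
  assumes p: "1 < p" and f: "\<And>i. i \<in> A \<Longrightarrow> f i \<in> Lp_space p"
  shows "(\<lambda>x. \<Sum>i\<in>A. f i x) \<in> Lp_space p \<and> Lp_norm p (\<lambda>x. \<Sum>i\<in>A. f i x) \<le> (\<Sum>i\<in>A. Lp_norm p (f i))"
  using f
proof (induction A rule: infinite_finite_induct)
  case (insert i A)
  then show ?case
    using Lp_space_add[OF p, of "f i" "\<lambda>x. \<Sum>i\<in>A. f i x"] Lp_norm_add[OF p, of "f i" "\<lambda>x. \<Sum>i\<in>A. f i x"] by fastforce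
qed (use p in \<open>simp_all add: Lp_space_0 Lp_norm_0\<close>)

lemma Lp_space_cmult: "f \<in> Lp_space p \<Longrightarrow> (\<lambda>x. c * f x) \<in> Lp_space p"
  by (auto simp: Lp_space_def abs_mult powr_mult)

lemma Lp_norm_minus: "Lp_norm p (\<lambda>x. - f x) = Lp_norm p f"
  by (simp add: Lp_norm_def)

lemma Lp_norm_diff_le:
  assumes "1 < p" "f \<in> Lp_space p" "g \<in> Lp_space p"
  shows "Lp_norm p (\<lambda>x. f x - g x) \<le> Lp_norm p f + Lp_norm p g"
  using Lp_norm_add[of p f "\<lambda>x. - g x"] Lp_space_cmult[of g p "-1"] assms by (simp add: Lp_norm_minus)

section \<open>Step functions on the grid\<close>

definition step :: "nat \<Rightarrow> (nat ^ 'd \<Rightarrow> real) \<Rightarrow> real ^ 'd::finite \<Rightarrow> real" where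
  "step n G x = (\<Sum>j\<in>grid n. G j * indicator (cell n j) x)"

lemma step_eq: "x \<in> hcube \<Longrightarrow> step n G x = G (cell_index n x)"
  unfolding step_def by (rule sum_cell_index)

lemma step_measurable [measurable]: "step n G \<in> borel_measurable Q"
  unfolding step_def by (intro borel_measurable_sum borel_measurable_times borel_measurable_indicator cell_in_sets) auto

lemma has_bochner_integral_step_powr:
  fixes G :: "nat ^ 'd::finite \<Rightarrow> real"
  shows "has_bochner_integral Q (\<lambda>x. \<bar>step n G x\<bar> powr p) ((1 / 2 ^ n) ^ CARD('d) * (\<Sum>j\<in>grid n. \<bar>G j\<bar> powr p))"
  by (rule has_bochner_integral_cell_index) (auto simp: step_eq)

lemma step_Lp_space: "step n G \<in> Lp_space p"
  using has_bochner_integral_step_powr[of n G p] by (auto simp: Lp_space_def integrable.simps)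

section \<open>Haar functions on the half-open cube\<close>

text \<open>\<open>Star\<close> gets level 0: like the wavelets of that level it has absolute value
  1 on all of \<open>hcube\<close>, so one formula covers both kinds.\<close>

fun lev :: "'d::finite haar_index \<Rightarrow> nat" where
  "lev Star = 0"
| "lev (Wavelet e k j) = k"

fun supp :: "'d::finite haar_index \<Rightarrow> (real ^ 'd) set" where
  "supp Star = hcube"
| "supp (Wavelet e k j) = cell k j"

lemma haar_indices_iff:
  "Star \<in> haar_indices" "Wavelet e k j \<in> haar_indices \<longleftrightarrow> e \<in> haar_vertices \<and> j \<in> grid k"
  by (auto simp: haar_indices_def grid_def)

lemma supp_in_sets: "I \<in> haar_indices \<Longrightarrow> supp I \<in> sets Q"
  by (cases I) (auto simp: haar_indices_iff grid_0 intro!: cell_in_sets)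

lemma measure_supp: "I \<in> haar_indices \<Longrightarrow> measure Q (supp I) = (1 / 2 ^ lev I) ^ CARD('d)"
  for I :: "'d::finite haar_index"
  by (cases I) (auto simp: haar_indices_iff grid_0 measure_Q_cell)

lemma abs_haar:
  fixes x :: "real ^ 'd::finite"
  assumes "x \<in> hcube"
  shows "\<bar>haar I x\<bar> = 2 powr (real (lev I) * real CARD('d) / 2) * indicator (supp I) x"
  using assms by (cases I) (auto simp: haar_Star_eq haar_Wavelet_eq mem_cell_iff abs_mult abs_walsh simp del: haar.simps)

lemma abs_haar_le:
  fixes x :: "real ^ 'd::finite"
  assumes "x \<in> hcube"
  shows "\<bar>haar I x\<bar> \<le> 2 powr (real (lev I) * real CARD('d) / 2)"
  using abs_haar[OF assms, of I] by (simp add: indicator_def)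

lemma integrable_mult_haar:
  fixes f :: "real ^ 'd::finite \<Rightarrow> real"
  assumes f: "integrable Q f"
  shows "integrable Q (\<lambda>x. f x * haar I x)"
proof (rule Bochner_Integration.integrable_bound)
  define B where "B = 2 powr (real (lev I) * real CARD('d) / 2)"
  show "integrable Q (\<lambda>x. B * f x)" using f by simp
  show "(\<lambda>x. f x * haar I x) \<in> borel_measurable Q"
    using borel_measurable_integrable[OF f] by simp
  show "AE x in Q. norm (f x * haar I x) \<le> norm (B * f x)"
    using AE_hcube
  proof eventually_elim
    case (elim x)
    show ?case
      using mult_left_mono[OF abs_haar_le[OF elim, of I], of "\<bar>f x\<bar>"]
      by (simp add: abs_mult B_def mult.commute)
  qed
qed

lemma has_bochner_integral_haar_powr:
  fixes I :: "'d::finite haar_index"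
  assumes I: "I \<in> haar_indices"
  shows "has_bochner_integral Q (\<lambda>x. \<bar>c * haar I x\<bar> powr p)
    ((\<bar>c\<bar> * 2 powr (real (lev I) * real CARD('d) / 2)) powr p * (1 / 2 ^ lev I) ^ CARD('d))"
proof -
  define B where "B = (\<bar>c\<bar> * 2 powr (real (lev I) * real CARD('d) / 2)) powr p"
  have "has_bochner_integral Q (\<lambda>x. B * indicator (supp I) x) (B * measure Q (supp I))"
    by (intro has_bochner_integral_mult_right has_bochner_integral_real_indicator supp_in_sets I)
      (simp add: finite_measure.emeasure_finite[OF finite_measure_Q] less_top[symmetric])
  moreover have "has_bochner_integral Q (\<lambda>x. B * indicator (supp I) x) y
      \<longleftrightarrow> has_bochner_integral Q (\<lambda>x. \<bar>c * haar I x\<bar> powr p) y" for y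
  proof (rule has_bochner_integral_cong_AE)
    show "AE x in Q. B * indicator (supp I) x = \<bar>c * haar I x\<bar> powr p"
      using AE_hcube
      by eventually_elim (auto simp: B_def abs_mult abs_haar indicator_def)
  qed (use supp_in_sets[OF I] in auto)
  ultimately show ?thesis using I by (simp add: measure_supp B_def)
qed

lemma haar_Lp_space: "I \<in> haar_indices \<Longrightarrow> haar I \<in> Lp_space p"
  using has_bochner_integral_haar_powr[of I 1 p] by (auto simp: Lp_space_def integrable.simps)

text \<open>The absolute value is constant on the support, so the p-th power of a term is there its
  integral divided by the measure of the support. In this way the norms compared by the greedy rule
  give pointwise bounds.\<close>

lemma abs_haar_powr:
  fixes x :: "real ^ 'd::finite"
  assumes I: "I \<in> haar_indices" and x: "x \<in> hcube" and p: "0 < p"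
  shows "\<bar>c * haar I x\<bar> powr p
    = Lp_norm p (\<lambda>x. c * haar I x) powr p * ((2 ^ lev I) ^ CARD('d) * indicator (supp I) x)"
proof -
  have "Lp_norm p (\<lambda>x. c * haar I x) powr p
    = (\<bar>c\<bar> * 2 powr (real (lev I) * real CARD('d) / 2)) powr p * (1 / 2 ^ lev I) ^ CARD('d)"
    using has_bochner_integral_integral_eq[OF has_bochner_integral_haar_powr[OF I, of c p]] p
    by (simp add: Lp_norm_powr)
  then show ?thesis
    by (auto simp: abs_mult abs_haar[OF x] indicator_def power_one_over)
qed

lemma integral_supp:
  "I \<in> haar_indices \<Longrightarrow> has_bochner_integral Q (\<lambda>x. (2 ^ lev I) ^ CARD('d) * indicator (supp I) x) (1 :: real)"
  for I :: "'d::finite haar_index"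
  using has_bochner_integral_mult_right[OF has_bochner_integral_real_indicator[OF supp_in_sets[of I]], of "(2 ^ lev I) ^ CARD('d)"]
  by (simp add: measure_supp power_one_over finite_measure.emeasure_finite[OF finite_measure_Q] less_top[symmetric])

lemma haar_vertices_eq: "haar_vertices = children 0 - {0}"
  by (auto simp: haar_vertices_def children_eq)

lemma finite_haar_vertices: "finite (haar_vertices :: (nat ^ 'd::finite) set)"
  by (simp add: haar_vertices_eq finite_children)

lemma card_haar_vertices: "card (haar_vertices :: (nat ^ 'd::finite) set) = 2 ^ CARD('d) - 1"
  unfolding haar_vertices_eq
  by (subst card_Diff_singleton) (simp_all add: card_children, simp add: children_def parent_def vec_eq_iff)

lemma haar_vertices_nonempty: "haar_vertices \<noteq> ({} :: (nat ^ 'd::finite) set)"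
proof -
  have "(1 :: nat ^ 'd) \<in> haar_vertices" by (auto simp: haar_vertices_def vec_eq_iff)
  then show ?thesis by blast
qed

section \<open>Orthonormality\<close>

lemma cell_index_ancestor:
  assumes x: "x \<in> hcube"
  shows "cell_index m x = (parent ^^ n) (cell_index (m + n) x)"
  by (induction n) (simp_all add: parent_cell_index[OF x] funpow_swap1)

text \<open>\<open>h\<close> is constant on the cell of the wavelet, and the Walsh signs of its
  children add up to 0. Applied to a coarser Haar function this is orthogonality across
  levels.\<close>

lemma integral_haar_coarse:
  fixes G :: "nat ^ 'd::finite \<Rightarrow> real"
  assumes e: "e \<in> haar_vertices" and j: "j \<in> grid k" and h: "h \<in> borel_measurable Q"
    and hG: "\<And>x. x \<in> hcube \<Longrightarrow> h x = G (cell_index k x)"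
  shows "(\<integral>x. h x * haar (Wavelet e k j) x \<partial>Q) = 0"
proof -
  define s where "s = 2 powr (real k * real CARD('d) / 2)"
  have "has_bochner_integral Q (\<lambda>x. h x * haar (Wavelet e k j) x)
      ((1 / 2 ^ Suc k) ^ CARD('d) * (\<Sum>y\<in>grid (Suc k). G j * s * (if parent y = j then walsh e y else 0)))"
    by (rule has_bochner_integral_cell_index)
      (use h in \<open>auto simp: haar_Wavelet_eq hG parent_cell_index s_def simp del: haar.simps\<close>)
  moreover have "(\<Sum>y\<in>grid (Suc k). G j * s * (if parent y = j then walsh e y else 0)) = 0"
  proof -
    have "(\<Sum>y\<in>grid (Suc k). if parent y = j then walsh e y else 0) = (\<Sum>y\<in>children j. walsh e y)"
      using children_subset_grid[OF j]
      by (subst sum.inter_filter[symmetric]) (auto simp: finite_grid children_def intro!: sum.cong)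
    then show ?thesis
      using sum_walsh[of e j] e by (simp add: sum_distrib_left[symmetric] haar_vertices_def)
  qed
  ultimately show ?thesis by (auto dest: has_bochner_integral_integral_eq)
qed

text \<open>Different cells of one level are disjoint; on a common cell the integral is a sum of
  products of Walsh signs over the children. Distinct vertices differ in a coordinate where exactly
  one of them vanishes, as \<open>walsh_orthogonal\<close> requires.\<close>

lemma integral_haar_same_level:
  fixes e e' :: "nat ^ 'd::finite"
  assumes e: "e \<in> haar_vertices" "e' \<in> haar_vertices" and j: "j \<in> grid k"
  shows "(\<integral>x. haar (Wavelet e k j) x * haar (Wavelet e' k j') x \<partial>Q) = (if e = e' \<and> j = j' then 1 else 0)"
proof -
  define s where "s = 2 powr (real k * real CARD('d) / 2)"
  have s2: "s * s = (2 ^ k) ^ CARD('d)"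
    by (simp add: s_def powr_add[symmetric] powr_realpow[symmetric] powr_powr)
  define F where "F y = s * s * (if parent y = j \<and> j = j' then walsh e y * walsh e' y else 0)" for y
  have I: "has_bochner_integral Q (\<lambda>x. haar (Wavelet e k j) x * haar (Wavelet e' k j') x)
      ((1 / 2 ^ Suc k) ^ CARD('d) * (\<Sum>y\<in>grid (Suc k). F y))"
    by (rule has_bochner_integral_cell_index)
      (auto simp: haar_Wavelet_eq parent_cell_index s_def F_def simp del: haar.simps)
  have "(\<Sum>y\<in>grid (Suc k). F y) = (if j = j' then s * s * (\<Sum>y\<in>children j. walsh e y * walsh e' y) else 0)"
  proof (cases "j = j'")
    case True
    have "(\<Sum>y\<in>grid (Suc k). if parent y = j then walsh e y * walsh e' y else 0) = (\<Sum>y\<in>children j. walsh e y * walsh e' y)"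
      using children_subset_grid[OF j]
      by (subst sum.inter_filter[symmetric]) (auto simp: finite_grid children_def intro!: sum.cong)
    then show ?thesis using True by (simp add: F_def sum_distrib_left[symmetric])
  qed (simp add: F_def)
  moreover have "(\<Sum>y\<in>children j. walsh e y * walsh e' y) = (if e = e' then 2 ^ CARD('d) else 0)"
  proof (cases "e = e'")
    case True then show ?thesis by (simp add: walsh_square card_children)
  next
    case False
    then obtain i where "e $ i \<noteq> e' $ i" by (auto simp: vec_eq_iff)
    moreover have "e $ i \<in> {0, 1}" "e' $ i \<in> {0, 1}" using e by (auto simp: haar_vertices_def)
    ultimately have "(e $ i = 0) \<noteq> (e' $ i = 0)" by auto
    then show ?thesis using False walsh_orthogonal by simp
  qed
  ultimately have "(\<Sum>y\<in>grid (Suc k). F y) = (if e = e' \<and> j = j' then (2 ^ k) ^ CARD('d) * 2 ^ CARD('d) else 0)"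
    unfolding s2 by auto
  then show ?thesis
    using has_bochner_integral_integral_eq[OF I]
    by (auto simp: power_mult_distrib power_one_over simp del: haar.simps)
qed

lemma haar_orthonormal:
  fixes I J :: "'d::finite haar_index"
  assumes I: "I \<in> haar_indices" and J: "J \<in> haar_indices"
  shows "(\<integral>x. haar I x * haar J x \<partial>Q) = (if I = J then 1 else 0)"
proof -
  have S: "(\<integral>x. haar Star x * haar (Wavelet e k j) x \<partial>Q) = 0"
    if "e \<in> haar_vertices" "j \<in> grid k" for e :: "nat ^ 'd" and k j
    by (rule integral_haar_coarse[where G = "\<lambda>_. 1"]) (use that in \<open>auto simp: haar_Star_eq simp del: haar.simps\<close>)
  \<comment> \<open>The coarser wavelet is constant on the cells of the finer level: its cell and
    its sign are read off from ancestors of the finer cell. For the sign,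
    \<open>Suc k \<le> k'\<close> is what matters.\<close>
  have W: "(\<integral>x. haar (Wavelet e k j) x * haar (Wavelet e' k' j') x \<partial>Q) = 0"
    if "e' \<in> haar_vertices" "j' \<in> grid k'" "k < k'" for e e' :: "nat ^ 'd" and k k' j j'
  proof (rule integral_haar_coarse[where G = "\<lambda>y. 2 powr (real k * real CARD('d) / 2) *
      (if (parent ^^ (k' - k)) y = j then walsh e ((parent ^^ (k' - Suc k)) y) else 0)"])
    fix x :: "real ^ 'd" assume x: "x \<in> hcube"
    show "haar (Wavelet e k j) x = 2 powr (real k * real CARD('d) / 2) *
      (if (parent ^^ (k' - k)) (cell_index k' x) = j then walsh e ((parent ^^ (k' - Suc k)) (cell_index k' x)) else 0)"
    proof -
      have 1: "cell_index k x = (parent ^^ (k' - k)) (cell_index k' x)"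
        using cell_index_ancestor[OF x, of k "k' - k"] \<open>k < k'\<close> by (simp only: le_add_diff_inverse less_imp_le)
      have 2: "cell_index (Suc k) x = (parent ^^ (k' - Suc k)) (cell_index k' x)"
        using cell_index_ancestor[OF x, of "Suc k" "k' - Suc k"] \<open>k < k'\<close> by (simp only: le_add_diff_inverse Suc_le_eq)
      show ?thesis unfolding haar_Wavelet_eq[OF x] 1 2 ..
    qed
  qed (rule that haar_measurable)+
  show ?thesis
  proof (cases I; cases J)
    assume "I = Star" "J = Star"
    moreover have "has_bochner_integral Q (\<lambda>x :: real ^ 'd. haar Star x * haar Star x) ((1 / 2 ^ 0) ^ CARD('d) * (\<Sum>j\<in>(grid 0 :: (nat ^ 'd) set). 1))"
      by (rule has_bochner_integral_cell_index) (auto simp: haar_Star_eq simp del: haar.simps)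
    ultimately show ?thesis by (simp add: grid_0 has_bochner_integral_integral_eq del: haar.simps)
  next
    fix e k j assume "I = Star" "J = Wavelet e k j"
    then show ?thesis using S J by (simp add: haar_indices_iff del: haar.simps)
  next
    fix e k j assume "I = Wavelet e k j" "J = Star"
    then show ?thesis using S I by (simp add: haar_indices_iff mult.commute del: haar.simps)
  next
    fix e k j e' k' j' assume IJ: "I = Wavelet e k j" "J = Wavelet e' k' j'"
    consider "k < k'" | "k = k'" | "k' < k" by linarith
    then show ?thesis
    proof cases
      case 1
      then show ?thesis using W[of e' j' k' k e j] IJ J by (simp add: haar_indices_iff del: haar.simps)
    next
      case 2
      then show ?thesis using integral_haar_same_level[of e e' j k j'] IJ I J by (simp add: haar_indices_iff del: haar.simps)
    next
      case 3
      then show ?thesis using W[of e j k k' e' j'] IJ I by (simp add: haar_indices_iff mult.commute del: haar.simps)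
    qed
  qed
qed

text \<open>By orthonormality, subtracting an approximant supported on \<open>P\<close> leaves the
  coefficients off \<open>P\<close> unchanged.\<close>

lemma haar_coeff_diff_sum:
  fixes g :: "real ^ 'd::finite \<Rightarrow> real"
  assumes g: "integrable Q g" and P: "finite P" "P \<subseteq> haar_indices" and J: "J \<in> haar_indices"
  shows "haar_coeff (\<lambda>x. g x - (\<Sum>I\<in>P. a I * haar I x)) J = haar_coeff g J - (if J \<in> P then a J else 0)"
proof -
  have h: "integrable Q (haar I)" if "I \<in> P" for I
    using that P haar_Lp_space[of I 1] by (intro Lp_space_integrable[of 1]) auto
  have "haar_coeff (\<lambda>x. g x - (\<Sum>I\<in>P. a I * haar I x)) J
    = (\<integral>x. g x * haar J x - (\<Sum>I\<in>P. a I * (haar I x * haar J x)) \<partial>Q)"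
    unfolding haar_coeff_def by (simp add: left_diff_distrib sum_distrib_right mult.assoc)
  also have "\<dots> = (\<integral>x. g x * haar J x \<partial>Q) - (\<integral>x. (\<Sum>I\<in>P. a I * (haar I x * haar J x)) \<partial>Q)"
    by (intro Bochner_Integration.integral_diff integrable_mult_haar Bochner_Integration.integrable_sum
      integrable_mult_right g h)
  also have "(\<integral>x. (\<Sum>I\<in>P. a I * (haar I x * haar J x)) \<partial>Q) = (\<Sum>I\<in>P. \<integral>x. a I * (haar I x * haar J x) \<partial>Q)"
    by (intro Bochner_Integration.integral_sum integrable_mult_haar integrable_mult_right h)
  also have "\<dots> = (\<Sum>I\<in>P. a I * (\<integral>x. haar I x * haar J x \<partial>Q))"
    unfolding integral_mult_right_zero ..
  also have "(\<Sum>I\<in>P. a I * (\<integral>x. haar I x * haar J x \<partial>Q)) = (\<Sum>I\<in>P. if I = J then a I else 0)"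
    using P J by (intro sum.cong) (auto simp: haar_orthonormal)
  also have "\<dots> = (if J \<in> P then a J else 0)" using P by simp
  finally show ?thesis by (simp add: haar_coeff_def)
qed

section \<open>Multipliers\<close>

text \<open>The wavelets of level below \<open>n\<close> are those that are constant on the cells of
  level \<open>n\<close>. \<open>Star\<close> belongs to the set even for
  \<open>n = 0\<close>.\<close>

definition haar_below :: "nat \<Rightarrow> 'd::finite haar_index set" where
  "haar_below n = insert Star ((\<lambda>(e, k, j). Wavelet e k j) ` (haar_vertices \<times> (SIGMA k:{..<n}. grid k)))"

lemma finite_haar_below: "finite (haar_below n)"
  by (auto simp: haar_below_def finite_haar_vertices finite_grid)

lemma mem_haar_below_iff: "I \<in> haar_below n \<longleftrightarrow> I \<in> haar_indices \<and> (I = Star \<or> lev I < n)"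
  by (cases I) (auto simp: haar_below_def haar_indices_iff image_iff)

lemma sum_haar_below:
  "(\<Sum>I\<in>haar_below n. F I) = F Star + (\<Sum>e\<in>haar_vertices. \<Sum>k<n. \<Sum>j\<in>grid k. F (Wavelet e k j) :: real)"
proof -
  have "inj_on (\<lambda>(e, k, j). Wavelet e k j) A" for A :: "((nat ^ 'a) \<times> nat \<times> (nat ^ 'a)) set"
    by (auto simp: inj_on_def)
  then have "(\<Sum>I\<in>(\<lambda>(e, k, j). Wavelet e k j) ` (haar_vertices \<times> (SIGMA k:{..<n}. grid k)). F I)
    = (\<Sum>(e, k, j)\<in>haar_vertices \<times> (SIGMA k:{..<n}. grid k). F (Wavelet e k j))"
    by (subst sum.reindex) (auto simp: case_prod_unfold)
  also have "\<dots> = (\<Sum>e\<in>haar_vertices. \<Sum>k<n. \<Sum>j\<in>grid k. F (Wavelet e k j))"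
    by (simp add: sum.cartesian_product[symmetric] sum.Sigma finite_grid)
  finally show ?thesis
    unfolding haar_below_def by (subst sum.insert) (auto simp: finite_haar_vertices finite_grid)
qed

lemma finite_subset_haar_below:
  assumes "finite B" "B \<subseteq> haar_indices"
  shows "\<exists>n. B \<subseteq> haar_below n"
proof
  show "B \<subseteq> haar_below (Suc (\<Sum>I\<in>B. lev I))"
    using assms member_le_sum[of _ B lev] by (auto simp: mem_haar_below_iff less_Suc_eq_le)
qed

lemma transform_cell_index:
  assumes x: "x \<in> hcube"
  shows "transform s \<theta> A e n (cell_index n x) = s * A 0 0
    + (\<Sum>k<n. \<theta> k (cell_index k x) * walsh_coeff A e k (cell_index k x) * walsh e (cell_index (Suc k) x))"
proof (induction n)
  case 0
  show ?case using cell_index_mem_grid[OF x, of 0] by (simp add: grid_0)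
qed (simp add: parent_cell_index[OF x])

text \<open>Each vertex gives one martingale transform. The constant term must be counted once, so
  it is assigned to an arbitrary vertex \<open>e0\<close> and the other transforms start at
  0.\<close>

lemma haar_sum_eq_transforms:
  fixes f :: "real ^ 'd::finite \<Rightarrow> real"
  assumes f: "integrable Q f" and x: "x \<in> hcube" and e0: "e0 \<in> haar_vertices"
  shows "(\<Sum>I\<in>haar_below n. \<theta> I * (haar_coeff f I * haar I x))
    = (\<Sum>e\<in>haar_vertices. transform (if e = e0 then \<theta> Star else 0) (\<lambda>k j. \<theta> (Wavelet e k j)) (avg f) e n (cell_index n x))"
proof -
  have "(\<Sum>j\<in>grid k. \<theta> (Wavelet e k j) * (haar_coeff f (Wavelet e k j) * haar (Wavelet e k j) x))
    = \<theta> (Wavelet e k (cell_index k x)) * walsh_coeff (avg f) e k (cell_index k x) * walsh e (cell_index (Suc k) x)" for e k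
  proof -
    have "(\<Sum>j\<in>grid k. \<theta> (Wavelet e k j) * (haar_coeff f (Wavelet e k j) * haar (Wavelet e k j) x))
      = (\<Sum>j\<in>grid k. if cell_index k x = j then
          \<theta> (Wavelet e k j) * walsh_coeff (avg f) e k j * walsh e (cell_index (Suc k) x) else 0)"
      by (intro sum.cong refl) (simp add: haar_Wavelet_eq[OF x] haar_coeff_Wavelet[OF f, symmetric] del: haar.simps)
    then show ?thesis using cell_index_mem_grid[OF x] by (simp add: finite_grid del: haar.simps)
  qed
  moreover have "(\<Sum>e\<in>haar_vertices. (if e = e0 then \<theta> Star else 0) * avg f 0 0) = \<theta> Star * avg f 0 0"
    using e0 by (simp add: if_distrib[of "\<lambda>t. t * _"] finite_haar_vertices cong: if_cong)
  ultimately show ?thesis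
    using haar_coeff_Star[OF borel_measurable_integrable[OF f]] haar_Star_eq[OF x]
    by (simp add: sum_haar_below transform_cell_index[OF x] sum.distrib del: haar.simps)
qed

text \<open>The sum is a step function made of one transform per vertex. Each has norm at most
  \<open>1 / (p - 1)\<close> times that of the averages of \<open>f\<close>, which Jensen's
  inequality bounds by the norm of \<open>f\<close>; the triangle inequality gives the factor
  \<open>2 ^ d - 1\<close>.\<close>

lemma haar_multiplier_bound:
  fixes f :: "real ^ 'd::finite \<Rightarrow> real"
  assumes p: "1 < p" "p \<le> 2" and f: "f \<in> Lp_space p"
    and B: "finite B" "B \<subseteq> haar_indices" and \<theta>: "\<And>I. \<theta> I \<in> {-1, 0, 1}"
  shows "Lp_norm p (\<lambda>x. \<Sum>I\<in>B. \<theta> I * (haar_coeff f I * haar I x))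
    \<le> (2 ^ CARD('d) - 1) * (1 / (p - 1)) * Lp_norm p f"
proof -
  have fi: "integrable Q f" using Lp_space_integrable[of p f] p f by simp
  obtain n where n: "B \<subseteq> haar_below n" using finite_subset_haar_below[OF B] by blast
  obtain e0 :: "nat ^ 'd" where e0: "e0 \<in> haar_vertices" using haar_vertices_nonempty by blast
  \<comment> \<open>Extension by 0 off \<open>B\<close> keeps the entries in {-1, 0, 1}, so a
    partial sum counts as a multiplier.\<close>
  define \<eta> where "\<eta> I = (if I \<in> B then \<theta> I else 0)" for I
  define T where "T e = transform (if e = e0 then \<eta> Star else 0) (\<lambda>k j. \<eta> (Wavelet e k j)) (avg f) e n" for e
  have \<eta>: "\<eta> I \<in> {-1, 0, 1}" for I using \<theta> by (simp add: \<eta>_def)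
  have step_bound: "Lp_norm p (step n (T e)) \<le> 1 / (p - 1) * Lp_norm p f" if e: "e \<in> haar_vertices" for e
  proof -
    have "(\<integral>x. \<bar>step n (T e) x\<bar> powr p \<partial>Q) = (1 / 2 ^ n) ^ CARD('d) * (\<Sum>j\<in>grid n. \<bar>T e j\<bar> powr p)"
      by (rule has_bochner_integral_integral_eq[OF has_bochner_integral_step_powr])
    also have "\<dots> \<le> (1 / 2 ^ n) ^ CARD('d) * ((1 / (p - 1)) powr p * (\<Sum>j\<in>grid n. \<bar>avg f n j\<bar> powr p))"
      unfolding T_def using e \<eta>
      by (intro mult_left_mono transform_powr_bound p martingale_avg fi) (auto simp: haar_vertices_def)
    also have "\<dots> = (1 / (p - 1)) powr p * ((1 / 2 ^ n) ^ CARD('d) * (\<Sum>j\<in>grid n. \<bar>avg f n j\<bar> powr p))" by simp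
    also have "\<dots> \<le> (1 / (p - 1)) powr p * (\<integral>x. \<bar>f x\<bar> powr p \<partial>Q)"
      by (intro mult_left_mono sum_avg_powr_le p f) simp
    also have "\<dots> = (1 / (p - 1) * Lp_norm p f) powr p"
      using p Lp_norm_powr[of p f] by (simp add: powr_mult powr_divide)
    finally show ?thesis using p by (subst Lp_norm_le_iff) auto
  qed
  have "(\<Sum>I\<in>B. \<theta> I * (haar_coeff f I * haar I x)) = (\<Sum>e\<in>haar_vertices. step n (T e) x)" if x: "x \<in> hcube" for x
  proof -
    have "(\<Sum>I\<in>B. \<theta> I * (haar_coeff f I * haar I x)) = (\<Sum>I\<in>haar_below n. \<eta> I * (haar_coeff f I * haar I x))"
      using n by (intro sum.mono_neutral_cong_left finite_haar_below) (auto simp: \<eta>_def)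
    then show ?thesis by (simp add: haar_sum_eq_transforms[OF fi x e0] T_def step_eq[OF x])
  qed
  then have "Lp_norm p (\<lambda>x. \<Sum>I\<in>B. \<theta> I * (haar_coeff f I * haar I x)) = Lp_norm p (\<lambda>x. \<Sum>e\<in>haar_vertices. step n (T e) x)"
    by (intro Lp_norm_cong borel_measurable_sum borel_measurable_times borel_measurable_const haar_measurable step_measurable)
  also have "\<dots> \<le> (\<Sum>e\<in>haar_vertices. Lp_norm p (step n (T e)))"
    using Lp_norm_sum[of p haar_vertices "\<lambda>e. step n (T e)"] p step_Lp_space by auto
  also have "\<dots> \<le> of_nat (card (haar_vertices :: (nat ^ 'd) set)) * (1 / (p - 1) * Lp_norm p f)"
    by (intro sum_bounded_above step_bound)
  finally show ?thesis by (simp add: card_haar_vertices of_nat_diff)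
qed

section \<open>Democracy\<close>

text \<open>A discrete form of integrating \<open>p * u powr (p - 1)\<close>: from one level to the
  next, convexity bounds the increase of \<open>S powr p\<close> by \<open>p\<close> times the
  increment of \<open>S\<close> times its new value to the power \<open>p - 1\<close>. All terms of
  one level enter together.\<close>

lemma powr_sum_le_partial_sums:
  fixes b :: "'a \<Rightarrow> real" and l :: "'a \<Rightarrow> nat"
  assumes p: "1 < p" and B: "finite B" and b: "\<And>i. i \<in> B \<Longrightarrow> 0 \<le> b i"
  shows "(\<Sum>i\<in>B. b i) powr p \<le> p * (\<Sum>i\<in>B. b i * (\<Sum>j\<in>{j\<in>B. l j \<le> l i}. b j) powr (p - 1))"
proof -
  define S where "S n = (\<Sum>j\<in>{j\<in>B. l j < n}. b j)" for n
  have S0: "0 \<le> S n" for n unfolding S_def using b by (intro sum_nonneg) auto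
  have "S n powr p \<le> p * (\<Sum>i\<in>{i\<in>B. l i < n}. b i * S (Suc (l i)) powr (p - 1))" for n
  proof (induction n)
    case 0 then show ?case using p by (simp add: S_def)
  next
    case (Suc n)
    have split: "(\<Sum>i\<in>{i\<in>B. l i < Suc n}. g i) = (\<Sum>i\<in>{i\<in>B. l i < n}. g i) + (\<Sum>i\<in>{i\<in>B. l i = n}. g i)"
      for g :: "'a \<Rightarrow> real"
      using B by (subst sum.union_disjoint[symmetric]) (auto intro!: sum.cong)
    have "S (Suc n) powr p \<le> S n powr p + p * (S (Suc n) - S n) * S (Suc n) powr (p - 1)"
    proof (cases "S (Suc n) = 0")
      case False
      then have "0 < S (Suc n)" using S0[of "Suc n"] by simp
      then show ?thesis
        using powr_abs_tangent[OF p, of "S (Suc n)" "S n"] S0[of n] by (simp add: algebra_simps)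
    qed (use p in simp)
    also have "S (Suc n) - S n = (\<Sum>i\<in>{i\<in>B. l i = n}. b i)" unfolding S_def split by simp
    also have "p * (\<Sum>i\<in>{i\<in>B. l i = n}. b i) * S (Suc n) powr (p - 1)
      = p * (\<Sum>i\<in>{i\<in>B. l i = n}. b i * S (Suc (l i)) powr (p - 1))"
      by (simp add: sum_distrib_right)
    also have "S n powr p + \<dots> \<le> p * (\<Sum>i\<in>{i\<in>B. l i < n}. b i * S (Suc (l i)) powr (p - 1))
      + p * (\<Sum>i\<in>{i\<in>B. l i = n}. b i * S (Suc (l i)) powr (p - 1))"
      using Suc by simp
    finally show ?case unfolding split by (simp add: distrib_left)
  qed
  from this[of "Suc (\<Sum>i\<in>B. l i)"] have *: "S (Suc (\<Sum>i\<in>B. l i)) powr p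
    \<le> p * (\<Sum>i\<in>{i\<in>B. l i < Suc (\<Sum>i\<in>B. l i)}. b i * S (Suc (l i)) powr (p - 1))" .
  have "{i\<in>B. l i < Suc (\<Sum>i\<in>B. l i)} = B"
    using member_le_sum[of _ B l] B by (auto simp: less_Suc_eq_le)
  with * show ?thesis by (simp add: S_def less_Suc_eq_le)
qed

text \<open>The constant function is absorbed into the geometric series because \<open>r \<le> 2 ^ d\<close>.\<close>

lemma sum_supp_le:
  fixes B :: "'d::finite haar_index set" and r :: real
  assumes B: "finite B" "B \<subseteq> haar_indices" and x: "x \<in> hcube" and r: "1 < r" "r \<le> 2 ^ CARD('d)"
  shows "(\<Sum>I\<in>{I\<in>B. lev I \<le> L}. r ^ lev I * indicator (supp I) x) \<le> (2 ^ CARD('d) - 1) * (r / (r - 1)) * r ^ L"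
proof -
  define \<mu> :: real where "\<mu> = 2 ^ CARD('d) - 1"
  have \<mu>: "r - 1 \<le> \<mu>" using r by (simp add: \<mu>_def)
  have "(\<Sum>I\<in>{I\<in>B. lev I \<le> L}. r ^ lev I * indicator (supp I) x)
    \<le> (\<Sum>I\<in>haar_below (Suc L). r ^ lev I * indicator (supp I) x)"
    using B r by (intro sum_mono2 finite_haar_below) (auto simp: mem_haar_below_iff less_Suc_eq_le)
  also have "\<dots> = 1 + (\<Sum>e\<in>(haar_vertices :: (nat ^ 'd) set). \<Sum>k<Suc L. \<Sum>j\<in>grid k. r ^ k * indicator (cell k j) x)"
    using x by (simp add: sum_haar_below del: sum.lessThan_Suc)
  also have "\<dots> = 1 + \<mu> * (\<Sum>k<Suc L. r ^ k)"
    using sum_cell_index[OF x, of "\<lambda>_. r ^ _"] by (simp add: card_haar_vertices of_nat_diff \<mu>_def)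
  also have "\<dots> = 1 + \<mu> * ((r ^ Suc L - 1) / (r - 1))"
    using r by (subst geometric_sum) auto
  also have "\<dots> \<le> \<mu> / (r - 1) + \<mu> * ((r ^ Suc L - 1) / (r - 1))"
    using \<mu> r by (intro add_right_mono) (simp add: le_divide_eq)
  also have "\<dots> = \<mu> * (r / (r - 1)) * r ^ L"
    by (simp add: add_divide_distrib[symmetric] algebra_simps)
  finally show ?thesis by (simp add: \<mu>_def)
qed

text \<open>Since \<open>r powr p = 2 ^ d\<close>, a term of norm at most \<open>t\<close> is
  bounded by \<open>t * r ^ lev I\<close> on its support. By \<open>sum_supp_le\<close> the partial
  sums up to a level are at most \<open>M\<close> times a term of that level that is nonzero at
  \<open>x\<close>, so the sum of p-th powers controls the p-th power of the sum. Integration makes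
  the bound linear in the number of terms.\<close>

lemma haar_sum_powr_le:
  fixes B :: "'d::finite haar_index set" and c :: "'d haar_index \<Rightarrow> real"
  assumes p: "1 < p" and B: "finite B" "B \<subseteq> haar_indices" and x: "x \<in> hcube"
    and t: "0 \<le> t" "\<And>I. I \<in> B \<Longrightarrow> Lp_norm p (\<lambda>x. c I * haar I x) \<le> t"
    and r: "r = 2 powr (real CARD('d) / p)" and M: "M = (2 ^ CARD('d) - 1) * (r / (r - 1))"
  shows "\<bar>\<Sum>I\<in>B. c I * haar I x\<bar> powr p
    \<le> t powr p * (p * M powr (p - 1) * (\<Sum>I\<in>B. (2 ^ lev I) ^ CARD('d) * indicator (supp I) x))"
proof -
  define b where "b I = r ^ lev I * (indicator (supp I) x :: real)" for I :: "'d haar_index"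
  have r1: "1 < r" using p by (simp add: r less_powr_iff)
  have "2 powr (real CARD('d) / p) \<le> 2 powr real CARD('d)"
    using p by (intro powr_mono) (auto simp: divide_le_eq)
  then have r2: "r \<le> 2 ^ CARD('d)" by (simp add: r powr_realpow)
  have M0: "0 \<le> M" using r1 by (simp add: M)
  have rk: "(r ^ k) powr p = (2 ^ k) ^ CARD('d)" for k
  proof -
    have "(r ^ k) powr p = (r powr p) ^ k" using r1 by (simp add: powr_power mult.commute powr_realpow[symmetric] powr_powr)
    also have "r powr p = 2 ^ CARD('d)" using p by (simp add: r powr_powr powr_realpow)
    finally show ?thesis by (simp add: power_mult[symmetric] mult.commute)
  qed
  have b0: "0 \<le> b I" for I using r1 by (simp add: b_def)
  have bp: "b I powr p = (2 ^ lev I) ^ CARD('d) * indicator (supp I) x" for I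
    by (simp add: b_def indicator_def rk)
  have le: "\<bar>c I * haar I x\<bar> \<le> t * b I" if I: "I \<in> B" for I
  proof -
    have "\<bar>c I * haar I x\<bar> powr p = Lp_norm p (\<lambda>x. c I * haar I x) powr p * b I powr p"
      using I B p x by (simp add: abs_haar_powr bp subset_iff)
    also have "\<dots> \<le> t powr p * b I powr p"
      using t I p by (intro mult_right_mono powr_mono2) auto
    also have "\<dots> = (t * b I) powr p" using t b0 by (simp add: powr_mult)
    finally show ?thesis
      using p t b0[of I] powr_less_mono2[of p "t * b I" "\<bar>c I * haar I x\<bar>"] by (auto simp: not_le[symmetric])
  qed
  have "\<bar>\<Sum>I\<in>B. c I * haar I x\<bar> \<le> (\<Sum>I\<in>B. t * b I)"
    by (rule order_trans[OF sum_abs]) (intro sum_mono le)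
  then have "\<bar>\<Sum>I\<in>B. c I * haar I x\<bar> powr p \<le> (t * (\<Sum>I\<in>B. b I)) powr p"
    using p by (intro powr_mono2) (auto simp: sum_distrib_left)
  also have "\<dots> = t powr p * (\<Sum>I\<in>B. b I) powr p"
    using t b0 by (simp add: powr_mult sum_nonneg)
  also have "\<dots> \<le> t powr p * (p * (\<Sum>I\<in>B. b I * (\<Sum>J\<in>{J\<in>B. lev J \<le> lev I}. b J) powr (p - 1)))"
    by (intro mult_left_mono powr_sum_le_partial_sums p B b0) simp
  also have "(\<Sum>I\<in>B. b I * (\<Sum>J\<in>{J\<in>B. lev J \<le> lev I}. b J) powr (p - 1))
    \<le> (\<Sum>I\<in>B. M powr (p - 1) * b I powr p)"
  proof (rule sum_mono)
    fix I assume "I \<in> B"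
    show "b I * (\<Sum>J\<in>{J\<in>B. lev J \<le> lev I}. b J) powr (p - 1) \<le> M powr (p - 1) * b I powr p"
    proof (cases "x \<in> supp I")
      case True
      then have bI: "b I = r ^ lev I" by (simp add: b_def)
      then have pos: "0 < b I" using r1 by simp
      have "(\<Sum>J\<in>{J\<in>B. lev J \<le> lev I}. b J) \<le> M * r ^ lev I"
        unfolding M b_def by (rule sum_supp_le[OF B x r1 r2])
      then have "(\<Sum>J\<in>{J\<in>B. lev J \<le> lev I}. b J) \<le> M * b I" by (simp only: bI)
      then have "b I * (\<Sum>J\<in>{J\<in>B. lev J \<le> lev I}. b J) powr (p - 1) \<le> b I * (M * b I) powr (p - 1)"
        using p b0 by (intro mult_left_mono powr_mono2 sum_nonneg) auto
      also have "\<dots> = M powr (p - 1) * (b I * b I powr (p - 1))" using M0 pos by (simp add: powr_mult)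
      also have "b I * b I powr (p - 1) = b I powr p" using pos by (simp add: powr_mult_base)
      finally show ?thesis .
    qed (simp add: b_def)
  qed
  finally show ?thesis
    using p t by (simp add: mult_left_mono bp sum_distrib_left mult.assoc)
qed

text \<open>Averaging over the two signs of \<open>a i\<close> with all other signs fixed cannot decrease the \<open>p\<close>-th power below \<open>\<bar>a i\<bar> ^ p\<close>.\<close>

lemma sum_signs_ge:
  fixes a :: "'a \<Rightarrow> real"
  assumes p: "1 < p" and B: "finite B" and i: "i \<in> B"
  shows "2 ^ card B * \<bar>a i\<bar> powr p \<le> (\<Sum>S\<in>Pow B. \<bar>\<Sum>j\<in>B. (if j \<in> S then 1 else -1) * a j\<bar> powr p)"
proof -
  define A where "A = B - {i}"
  have BA: "B = insert i A" "i \<notin> A" "finite A" using i B by (auto simp: A_def)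
  define F where "F S = \<bar>\<Sum>j\<in>B. (if j \<in> S then 1 else -1) * a j\<bar> powr p" for S
  define R where "R S = (\<Sum>j\<in>A. (if j \<in> S then 1 else -1) * a j)" for S
  have pair: "2 * \<bar>a i\<bar> powr p \<le> F S + F (insert i S)" if S: "S \<in> Pow A" for S
  proof -
    have "(\<Sum>j\<in>A. (if j \<in> insert i S then 1 else -1) * a j) = R S"
      unfolding R_def using BA by (intro sum.cong) auto
    then have "F S = \<bar>R S - a i\<bar> powr p" "F (insert i S) = \<bar>R S + a i\<bar> powr p"
      using S BA by (auto simp: F_def R_def algebra_simps)
    moreover have "\<bar>1/2 * (R S + a i) + 1/2 * (a i - R S)\<bar> powr p \<le> 1/2 * \<bar>R S + a i\<bar> powr p + 1/2 * \<bar>a i - R S\<bar> powr p"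
      by (rule powr_abs_convex[OF p]) auto
    moreover have "1/2 * (R S + a i) + 1/2 * (a i - R S) = a i" by (simp add: field_simps)
    ultimately show ?thesis by (simp add: abs_minus_commute)
  qed
  have "2 ^ card B * \<bar>a i\<bar> powr p = (\<Sum>S\<in>Pow A. 2 * \<bar>a i\<bar> powr p)"
    using BA by (simp add: card_Pow)
  also have "\<dots> \<le> (\<Sum>S\<in>Pow A. F S + F (insert i S))"
    by (intro sum_mono pair)
  also have "\<dots> = (\<Sum>S\<in>Pow A. F S) + (\<Sum>S\<in>insert i ` Pow A. F S)"
    using BA by (subst sum.reindex) (auto simp: sum.distrib inj_on_def)
  also have "\<dots> = (\<Sum>S\<in>Pow B. F S)"
    unfolding BA(1) Pow_insert using BA by (intro sum.union_disjoint[symmetric]) auto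
  finally show ?thesis by (simp add: F_def)
qed

text \<open>Among the indices whose support contains \<open>x\<close>, take an \<open>I\<close> of
  largest level. The sum is at most \<open>2 ^ d\<close> times its term at \<open>I\<close>, and the
  average over all signs dominates this single term.\<close>

lemma sum_supp_le_sum_signs:
  fixes B :: "'d::finite haar_index set" and c :: "'d haar_index \<Rightarrow> real"
  assumes p: "1 < p" and B: "finite B" "B \<subseteq> haar_indices" and x: "x \<in> hcube"
    and t: "0 \<le> t" "\<And>I. I \<in> B \<Longrightarrow> t \<le> Lp_norm p (\<lambda>x. c I * haar I x)"
  shows "2 ^ card B * (t powr p * (\<Sum>I\<in>B. (2 ^ lev I) ^ CARD('d) * indicator (supp I) x))
    \<le> 2 ^ CARD('d) * (\<Sum>S\<in>Pow B. \<bar>\<Sum>I\<in>B. (if I \<in> S then 1 else -1) * (c I * haar I x)\<bar> powr p)"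
proof (cases "\<exists>I\<in>B. x \<in> supp I")
  case False
  then have "(\<Sum>I\<in>B. (2 ^ lev I) ^ CARD('d) * indicator (supp I) x) = (0 :: real)"
    by (intro sum.neutral) auto
  then show ?thesis by (simp add: sum_nonneg)
next
  case True
  define Bx where "Bx = {I\<in>B. x \<in> supp I}"
  have fin: "finite (lev ` Bx)" and "lev ` Bx \<noteq> {}" using B True by (auto simp: Bx_def)
  then have "Max (lev ` Bx) \<in> lev ` Bx" by (rule Max_in)
  then obtain I where "I \<in> Bx" "lev I = Max (lev ` Bx)" by auto
  then have I: "I \<in> Bx" "\<And>J. J \<in> Bx \<Longrightarrow> lev J \<le> lev I" using fin by auto
  have IB: "I \<in> B" "x \<in> supp I" using I by (auto simp: Bx_def)
  have pow: "((2::real) ^ k) ^ CARD('d) = (2 ^ CARD('d)) ^ k" for k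
    by (simp add: power_mult[symmetric] mult.commute)
  have "(\<Sum>J\<in>B. (2 ^ lev J) ^ CARD('d) * indicator (supp J) x)
    = (\<Sum>J\<in>{J\<in>B. lev J \<le> lev I}. (2 ^ CARD('d)) ^ lev J * (indicator (supp J) x :: real))"
    unfolding pow using B I(2) by (intro sum.mono_neutral_right) (auto simp: Bx_def indicator_def)
  \<comment> \<open>For the ratio \<open>2 ^ d\<close> the constant of \<open>sum_supp_le\<close> is
    exactly \<open>2 ^ d\<close>.\<close>
  also have "\<dots> \<le> (2 ^ CARD('d) - 1) * (2 ^ CARD('d) / (2 ^ CARD('d) - 1)) * (2 ^ CARD('d)) ^ lev I"
    by (rule sum_supp_le[OF B x]) auto
  also have "\<dots> = 2 ^ CARD('d) * ((2 ^ lev I) ^ CARD('d))"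
  proof -
    have "(1 :: real) < 2 ^ CARD('d)" by simp
    then have "(2 :: real) ^ CARD('d) - 1 \<noteq> 0" by linarith
    then show ?thesis by (simp add: pow)
  qed
  finally have "2 ^ card B * (t powr p * (\<Sum>I\<in>B. (2 ^ lev I) ^ CARD('d) * indicator (supp I) x))
    \<le> 2 ^ card B * (t powr p * (2 ^ CARD('d) * (2 ^ lev I) ^ CARD('d)))"
    by (intro mult_left_mono) auto
  also have "\<dots> \<le> 2 ^ card B * (Lp_norm p (\<lambda>x. c I * haar I x) powr p * (2 ^ CARD('d) * (2 ^ lev I) ^ CARD('d)))"
    using t IB p by (intro mult_left_mono mult_right_mono powr_mono2) auto
  also have "\<dots> = 2 ^ CARD('d) * (2 ^ card B * \<bar>c I * haar I x\<bar> powr p)"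
    using IB B p x by (simp add: abs_haar_powr subset_iff)
  also have "\<dots> \<le> 2 ^ CARD('d) * (\<Sum>S\<in>Pow B. \<bar>\<Sum>I\<in>B. (if I \<in> S then 1 else -1) * (c I * haar I x)\<bar> powr p)"
    by (intro mult_left_mono sum_signs_ge[OF p B(1) IB(1)]) auto
  finally show ?thesis .
qed

lemma integral_mono_hcube:
  fixes f g :: "real ^ 'd::finite \<Rightarrow> real"
  assumes "integrable Q f" "integrable Q g" "\<And>x. x \<in> hcube \<Longrightarrow> f x \<le> g x"
  shows "(\<integral>x. f x \<partial>Q) \<le> (\<integral>x. g x \<partial>Q)"
  using AE_hcube by (intro integral_mono_AE assms) (auto elim!: eventually_mono intro: assms)

lemma integral_sum_supp:
  fixes B :: "'d::finite haar_index set"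
  assumes B: "finite B" "B \<subseteq> haar_indices"
  shows "has_bochner_integral Q (\<lambda>x. \<Sum>I\<in>B. (2 ^ lev I) ^ CARD('d) * indicator (supp I) x) (real (card B))"
  using has_bochner_integral_sum[of B Q "\<lambda>I x. (2 ^ lev I) ^ CARD('d) * indicator (supp I) x" "\<lambda>_. 1 :: real"]
    B integral_supp by (auto simp: subset_iff)

lemma haar_sum_Lp_space:
  assumes "1 < p" "finite B" "B \<subseteq> haar_indices"
  shows "(\<lambda>x. \<Sum>I\<in>B. a I * haar I x) \<in> Lp_space p"
proof -
  have "(\<lambda>x. \<Sum>I\<in>B. (\<lambda>x. a I * haar I x) x) \<in> Lp_space p"
    using assms by (intro Lp_norm_sum[THEN conjunct1] Lp_space_cmult haar_Lp_space) auto
  then show ?thesis by simp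
qed

text \<open>Averaging over all signs on \<open>B\<close>, each pattern being a multiplier with bound
  \<open>D\<close>, gives \<open>t powr p * card B \<le> 2 ^ d * D powr p\<close>. The integral over
  \<open>A\<close> is at most \<open>p * M powr (p - 1)\<close> times the left side, since both sets
  have the same size.\<close>

lemma haar_sum_comparison:
  fixes f :: "real ^ 'd::finite \<Rightarrow> real" and A B :: "'d haar_index set"
  assumes p: "1 < p" "p \<le> 2" and f: "f \<in> Lp_space p"
    and A: "finite A" "A \<subseteq> haar_indices" and B: "finite B" "B \<subseteq> haar_indices" and card: "card A = card B"
    and t: "0 \<le> t" "\<And>I. I \<in> A \<Longrightarrow> Lp_norm p (\<lambda>x. c I * haar I x) \<le> t"
      "\<And>I. I \<in> B \<Longrightarrow> t \<le> Lp_norm p (\<lambda>x. haar_coeff f I * haar I x)"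
    and r: "r = 2 powr (real CARD('d) / p)" and M: "M = (2 ^ CARD('d) - 1) * (r / (r - 1))"
  shows "Lp_norm p (\<lambda>x. \<Sum>I\<in>A. c I * haar I x)
    \<le> 2 * M * ((2 ^ CARD('d) - 1) * (1 / (p - 1)) * Lp_norm p f)"
proof -
  define D where "D = (2 ^ CARD('d) - 1) * (1 / (p - 1)) * Lp_norm p f"
  have D0: "0 \<le> D" using p by (simp add: D_def)
  have r1: "1 < r" using p by (simp add: r less_powr_iff)
  have "2 powr (real CARD('d) / p) \<le> 2 powr real CARD('d)"
    using p by (intro powr_mono) (auto simp: divide_le_eq)
  then have r2: "r \<le> 2 ^ CARD('d)" by (simp add: r powr_realpow)
  \<comment> \<open>This is \<open>2 ^ d \<le> M\<close> cleared of denominators; it follows from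
    \<open>r \<le> 2 ^ d\<close>.\<close>
  have "(2 ^ CARD('d)) * (r - 1) \<le> (2 ^ CARD('d) - 1) * r" using r2 by (simp add: algebra_simps)
  then have dM: "2 ^ CARD('d) \<le> M" using r1 by (simp add: M le_divide_eq)
  then have M0: "0 < M" by (smt (verit) zero_less_power)
  have int_supp: "integrable Q (\<lambda>x. \<Sum>I\<in>S. (2 ^ lev I) ^ CARD('d) * indicator (supp I) x :: real)"
    if "finite S" "S \<subseteq> haar_indices" for S :: "'d haar_index set"
    using integral_sum_supp[OF that] by (rule integrable.intros)
  note integral_supp = integral_sum_supp[THEN has_bochner_integral_integral_eq]
  define h where "h S x = (\<Sum>I\<in>B. (if I \<in> S then 1 else -1) * (haar_coeff f I * haar I x))" for S x
  have h_int: "integrable Q (\<lambda>x. \<bar>h S x\<bar> powr p)" for S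
    using haar_sum_Lp_space[OF p(1) B, of "\<lambda>I. (if I \<in> S then 1 else -1) * haar_coeff f I"]
    unfolding Lp_space_def h_def by (simp only: mult.assoc mem_Collect_eq)
  have h_le: "(\<integral>x. \<bar>h S x\<bar> powr p \<partial>Q) \<le> D powr p" for S
  proof -
    have "Lp_norm p (h S) \<le> D"
      unfolding h_def D_def by (intro haar_multiplier_bound p f B) auto
    then show ?thesis using p D0 Lp_norm_le_iff[of p D "h S"] by simp
  qed
  have "2 ^ card B * (t powr p * real (card B))
    = (\<integral>x. 2 ^ card B * (t powr p * (\<Sum>I\<in>B. (2 ^ lev I) ^ CARD('d) * indicator (supp I) x)) \<partial>Q)"
    unfolding integral_mult_right_zero integral_supp[OF B] ..
  also have "\<dots> \<le> (\<integral>x. 2 ^ CARD('d) * (\<Sum>S\<in>Pow B. \<bar>h S x\<bar> powr p) \<partial>Q)"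
    unfolding h_def
    by (intro integral_mono_hcube integrable_mult_right int_supp[OF B] Bochner_Integration.integrable_sum
        h_int[unfolded h_def] sum_supp_le_sum_signs p B t)
  also have "\<dots> = 2 ^ CARD('d) * (\<Sum>S\<in>Pow B. \<integral>x. \<bar>h S x\<bar> powr p \<partial>Q)"
    unfolding integral_mult_right_zero by (subst Bochner_Integration.integral_sum) (auto intro: h_int)
  also have "\<dots> \<le> 2 ^ CARD('d) * (of_nat (card (Pow B)) * D powr p)"
    by (intro mult_left_mono sum_bounded_above h_le) auto
  also have "\<dots> = 2 ^ card B * (2 ^ CARD('d) * D powr p)"
    using B by (simp add: card_Pow)
  finally have lower: "t powr p * real (card B) \<le> 2 ^ CARD('d) * D powr p"
    by simp
  have "(\<integral>x. \<bar>\<Sum>I\<in>A. c I * haar I x\<bar> powr p \<partial>Q)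
    \<le> (\<integral>x. t powr p * (p * M powr (p - 1) * (\<Sum>I\<in>A. (2 ^ lev I) ^ CARD('d) * indicator (supp I) x)) \<partial>Q)"
  proof (rule integral_mono_hcube)
    show "integrable Q (\<lambda>x. \<bar>\<Sum>I\<in>A. c I * haar I x\<bar> powr p)"
      using haar_sum_Lp_space[OF p(1) A, of c] by (simp add: Lp_space_def del: haar.simps)
    show "integrable Q (\<lambda>x. t powr p * (p * M powr (p - 1) * (\<Sum>I\<in>A. (2 ^ lev I) ^ CARD('d) * indicator (supp I) x)))"
      by (intro integrable_mult_right int_supp[OF A])
  qed (rule haar_sum_powr_le[OF p(1) A _ t(1,2) r M])
  also have "\<dots> = p * M powr (p - 1) * (t powr p * real (card B))"
    unfolding integral_mult_right_zero integral_supp[OF A] card by simp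
  also have "\<dots> \<le> p * M powr (p - 1) * (2 ^ CARD('d) * D powr p)"
    using p by (intro mult_left_mono lower) auto
  \<comment> \<open>Enlarging \<open>p\<close> to \<open>2 powr p\<close> and \<open>2 ^ d\<close>
    to \<open>M\<close> produces a full p-th power.\<close>
  also have "\<dots> \<le> 2 powr p * M powr (p - 1) * (M * D powr p)"
  proof (intro mult_mono)
    have "2 powr 1 \<le> 2 powr p" using p by (intro powr_mono) auto
    then show "p \<le> 2 powr p" using p by simp
  qed (use dM M0 p in auto)
  also have "\<dots> = (2 * M * D) powr p"
    using M0 D0 p by (simp add: powr_mult powr_mult_base mult_ac)
  finally show ?thesis
    using p M0 D0 by (simp add: Lp_norm_le_iff D_def)
qed

section \<open>The error of the greedy algorithm\<close>

text \<open>Put \<open>C = (2 ^ d - 1) * c\<close>. For \<open>d \<ge> 2\<close> one has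
  \<open>C \<ge> 3\<close>, so \<open>1 + C \<le> C\<^sup>2\<close>, and
  \<open>2 * K \<le> K\<^sup>2 + 1\<close> suffices. For \<open>d = 1\<close> the value
  \<open>C = 1\<close> is possible and the first inequality can fail; there \<open>K \<ge> 2\<close>
  gives \<open>2 * K \<le> K\<^sup>2\<close>.\<close>

lemma greedy_constant_le:
  fixes K c :: real and d :: nat
  assumes d: "d \<noteq> 0" and c: "1 \<le> c" and K: "0 \<le> K" and K2: "d = 1 \<Longrightarrow> 2 \<le> K"
  shows "1 + (2 ^ d - 1) * c + 2 * ((2 ^ d - 1) * K) * ((2 ^ d - 1) * c) \<le> (2 + K\<^sup>2) * ((2 ^ d - 1) * c)\<^sup>2"
proof -
  define \<mu> :: real where "\<mu> = 2 ^ d - 1"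
  have "(2 :: real) ^ 1 \<le> 2 ^ d" using d by (intro power_increasing) auto
  then have \<mu>: "1 \<le> \<mu>" by (simp add: \<mu>_def)
  define C where "C = \<mu> * c"
  have C: "\<mu> \<le> C" using mult_left_mono[OF c, of \<mu>] \<mu> by (simp add: C_def)
  have "1 * C \<le> C * C" using C \<mu> by (intro mult_right_mono) auto
  then have CC: "C \<le> C\<^sup>2" by (simp add: power2_eq_square)
  have "K * (\<mu> * C) \<le> K * (C * C)" using C \<mu> K by (intro mult_left_mono mult_right_mono) auto
  then have KC: "2 * (\<mu> * K) * C \<le> 2 * K * C\<^sup>2" by (simp add: power2_eq_square mult_ac)
  have "1 + C + 2 * K * C\<^sup>2 \<le> (2 + K\<^sup>2) * C\<^sup>2"
  proof (cases "d = 1")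
    case True
    have "2 * K * C\<^sup>2 \<le> K\<^sup>2 * C\<^sup>2"
      using K2[OF True] by (intro mult_right_mono) (auto simp: power2_eq_square intro: mult_right_mono)
    moreover have "1 \<le> C\<^sup>2" using C \<mu> by (simp add: one_le_power)
    ultimately show ?thesis using CC by (simp add: distrib_right)
  next
    case False
    then have "(2 :: real) ^ 2 \<le> 2 ^ d" using d by (intro power_increasing) auto
    then have "3 \<le> C" using C by (simp add: \<mu>_def)
    then have "3 * C \<le> C\<^sup>2" unfolding power2_eq_square by (intro mult_right_mono) auto
    then have "1 + C \<le> C\<^sup>2" using \<open>3 \<le> C\<close> by linarith
    moreover have "0 \<le> (K - 1)\<^sup>2" by simp
    then have "2 * K \<le> K\<^sup>2 + 1" by (simp add: power2_eq_square algebra_simps)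
    then have "2 * K * C\<^sup>2 \<le> (K\<^sup>2 + 1) * C\<^sup>2" by (intro mult_right_mono) auto
    ultimately show ?thesis by (simp add: distrib_right)
  qed
  then show ?thesis using KC unfolding \<mu>_def[symmetric] C_def[symmetric] by linarith
qed

text \<open>Off \<open>P\<close> the functions \<open>f\<close> and \<open>g\<close> have the same
  coefficients, so the norms over \<open>B\<close> belong to both. The smallest of them,
  \<open>t\<close>, bounds the norms over \<open>A\<close> by the greedy choice, and
  \<open>A\<close> and \<open>B\<close> have equal size because \<open>P\<close> and
  \<open>\<Lambda>\<close> do; so \<open>haar_sum_comparison\<close> applies.\<close>

lemma greedy_error_le:
  fixes g :: "real ^ 'd::finite \<Rightarrow> real" and \<Lambda> P :: "'d haar_index set"
  assumes p: "1 < p" "p \<le> 2" and g: "g \<in> Lp_space p" and greedy: "greedy_set p g m \<Lambda>"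
    and P: "P \<subseteq> haar_indices" "finite P" "card P = m"
    and r: "r = 2 powr (real CARD('d) / p)" and C: "C = (2 ^ CARD('d) - 1) * (1 / (p - 1))"
  shows "Lp_norm p (\<lambda>x. g x - greedy_sum g \<Lambda> x)
    \<le> (1 + C + 2 * ((2 ^ CARD('d) - 1) * (r / (r - 1))) * C) * Lp_norm p (\<lambda>x. g x - (\<Sum>I\<in>P. a I * haar I x))"
proof -
  define f where "f x = g x - (\<Sum>I\<in>P. a I * haar I x)" for x
  define N where "N I = Lp_norm p (\<lambda>x. haar_coeff g I * haar I x)" for I
  define A where "A = P - \<Lambda>"
  define B where "B = \<Lambda> - P"
  have \<Lambda>: "\<Lambda> \<subseteq> haar_indices" "finite \<Lambda>" "card \<Lambda> = m"
    and NJ: "\<And>I J. I \<in> \<Lambda> \<Longrightarrow> J \<in> haar_indices - \<Lambda> \<Longrightarrow> N J \<le> N I"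
    using greedy by (auto simp: greedy_set_def N_def)
  have f: "f \<in> Lp_space p"
    using Lp_space_add[OF p(1) g haar_sum_Lp_space[OF p(1) P(2,1), of "\<lambda>I. - a I"]]
    by (simp add: f_def[abs_def] sum_negf)
  have gi: "integrable Q g" using Lp_space_integrable[of p g] p g by simp
  have coeff: "haar_coeff f I = haar_coeff g I - (if I \<in> P then a I else 0)" if "I \<in> haar_indices" for I
    unfolding f_def by (rule haar_coeff_diff_sum[OF gi P(2,1) that])
  have AB: "finite A" "A \<subseteq> haar_indices" "finite B" "B \<subseteq> haar_indices"
    using P \<Lambda> by (auto simp: A_def B_def)
  have card: "card A = card B"
    unfolding A_def B_def using P \<Lambda> by (simp add: card_Diff_subset_Int Int_commute)
  \<comment> \<open>\<open>Min\<close> of the empty set is unspecified, hence the default 0; in that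
    case \<open>A\<close> is empty as well, having the same size.\<close>
  define t where "t = (if B = {} then 0 else Min (N ` B))"
  have tB: "t \<le> N I" if "I \<in> B" for I
    using that AB by (auto simp: t_def)
  have tN: "t = 0 \<and> B = {} \<or> (\<exists>I\<in>B. t = N I)"
  proof (cases "B = {}")
    case False
    then have "Min (N ` B) \<in> N ` B" using AB by (intro Min_in) auto
    then show ?thesis using False by (simp add: t_def image_iff)
  qed (simp add: t_def)
  then have t0: "0 \<le> t" by (auto simp: N_def)
  have tA: "N J \<le> t" if "J \<in> A" for J
  proof -
    have "B \<noteq> {}" using that card AB by auto
    then obtain I where "I \<in> B" "t = N I" using tN by blast
    then show ?thesis using that AB NJ[of I J] by (auto simp: A_def B_def)
  qed
  have comp: "Lp_norm p (\<lambda>x. \<Sum>I\<in>A. haar_coeff g I * haar I x)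
    \<le> 2 * ((2 ^ CARD('d) - 1) * (r / (r - 1))) * (C * Lp_norm p f)"
    unfolding C
  proof (rule haar_sum_comparison[OF p f AB card t0 _ _ r refl])
    fix I assume I: "I \<in> B"
    then have "haar_coeff f I = haar_coeff g I" using coeff AB by (auto simp: B_def)
    then show "t \<le> Lp_norm p (\<lambda>x. haar_coeff f I * haar I x)" using tB[OF I] by (simp add: N_def)
  qed (use tA in \<open>simp add: N_def\<close>)
  define S where "S x = (\<Sum>I\<in>P \<union> \<Lambda>. haar_coeff f I * haar I x)" for x
  have SL: "S \<in> Lp_space p"
    unfolding S_def using P \<Lambda> by (intro haar_sum_Lp_space p) auto
  have "Lp_norm p S \<le> C * Lp_norm p f"
    using haar_multiplier_bound[OF p f, of "P \<union> \<Lambda>" "\<lambda>_. 1"] P \<Lambda> by (simp add: S_def[abs_def] C)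
  then have fS: "Lp_norm p (\<lambda>x. f x - S x) \<le> Lp_norm p f + C * Lp_norm p f"
    using Lp_norm_diff_le[OF p(1) f SL] by simp
  \<comment> \<open>The approximant cancels between \<open>f\<close> and \<open>S\<close>. Beyond
    the greedy sum, \<open>S\<close> removes the terms of \<open>g\<close> over \<open>A\<close>,
    which are added back.\<close>
  have eq: "g x - greedy_sum g \<Lambda> x = (f x - S x) + (\<Sum>I\<in>A. haar_coeff g I * haar I x)" for x
  proof -
    have "S x = (\<Sum>I\<in>P \<union> \<Lambda>. haar_coeff g I * haar I x - (if I \<in> P then a I * haar I x else 0))"
      unfolding S_def using P \<Lambda> coeff by (intro sum.cong) (auto simp: left_diff_distrib simp del: haar.simps)
    also have "\<dots> = (\<Sum>I\<in>P \<union> \<Lambda>. haar_coeff g I * haar I x) - (\<Sum>I\<in>P. a I * haar I x)"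
      unfolding sum_subtractf using P \<Lambda>
      by (subst sum.inter_restrict[symmetric]) (auto simp: Int_absorb1)
    also have "P \<union> \<Lambda> = \<Lambda> \<union> A" by (auto simp: A_def)
    also have "(\<Sum>I\<in>\<Lambda> \<union> A. haar_coeff g I * haar I x) = greedy_sum g \<Lambda> x + (\<Sum>I\<in>A. haar_coeff g I * haar I x)"
      unfolding greedy_sum_def using \<Lambda> AB by (intro sum.union_disjoint) (auto simp: A_def)
    finally show ?thesis by (simp add: f_def)
  qed
  have "Lp_norm p (\<lambda>x. g x - greedy_sum g \<Lambda> x)
    \<le> Lp_norm p (\<lambda>x. f x - S x) + Lp_norm p (\<lambda>x. \<Sum>I\<in>A. haar_coeff g I * haar I x)"
    unfolding eq
    using Lp_space_add[OF p(1) f Lp_space_cmult[OF SL, of "-1"]] haar_sum_Lp_space[OF p(1) AB(1,2)]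
    by (intro Lp_norm_add p) auto
  also have "\<dots> \<le> (Lp_norm p f + C * Lp_norm p f) + 2 * ((2 ^ CARD('d) - 1) * (r / (r - 1))) * (C * Lp_norm p f)"
    by (intro add_mono fS comp)
  also have "\<dots> = (1 + C + 2 * ((2 ^ CARD('d) - 1) * (r / (r - 1))) * C) * Lp_norm p f"
    by (simp add: algebra_simps)
  finally show ?thesis by (simp add: f_def[abs_def])
qed

theorem theorem2p2:
  fixes p :: real and m :: nat
    and g :: "real ^ 'd::finite \<Rightarrow> real"
    and \<Lambda> :: "'d haar_index set"
  assumes "1 < p" and "p \<le> 2"
    and "g \<in> Lp_space p"
    and "greedy_set p g m \<Lambda>"
  shows "Lp_norm p (\<lambda>x. g x - greedy_sum g \<Lambda> x)
    \<le> (2 + 1 / (1 - (1 / 2) powr (real CARD('d) / p))\<^sup>2)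
       * ((2 ^ CARD('d) - 1) * (max p (p / (p - 1)) - 1))\<^sup>2
       * best_m_term p m g"
proof -
  define r where "r = 2 powr (real CARD('d) / p)"
  define K where "K = r / (r - 1)"
  define c where "c = max p (p / (p - 1)) - 1"
  define X where "X = (2 + K\<^sup>2) * ((2 ^ CARD('d) - 1) * c)\<^sup>2"
  have r1: "1 < r" using assms by (simp add: r_def less_powr_iff)
  \<comment> \<open>For \<open>p \<le> 2\<close> the conjugate exponent is the larger one, so
    \<open>c\<close> is \<open>1 / (p - 1)\<close>, the constant of the transform bound.\<close>
  have "p * (p - 1) \<le> p * 1" using assms by (intro mult_left_mono) auto
  then have "p \<le> p / (p - 1)" using assms by (simp add: le_divide_eq)
  then have c_eq: "c = 1 / (p - 1)" using assms by (simp add: c_def max_def field_simps)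
  then have c1: "1 \<le> c" using assms by (simp add: le_divide_eq)
  have "(1 / 2) powr (real CARD('d) / p) = 1 / r" by (simp add: r_def powr_divide)
  moreover have "1 / (1 - 1 / r) = K" using r1 by (simp add: K_def divide_simps)
  ultimately have K_eq: "1 / (1 - (1 / 2) powr (real CARD('d) / p))\<^sup>2 = K\<^sup>2"
    by (simp add: power_one_over[symmetric])
  \<comment> \<open>In dimension one \<open>r = 2 powr (1 / p)\<close> is at most 2, which is
    equivalent to \<open>r / (r - 1) \<ge> 2\<close>.\<close>
  have K2: "2 \<le> K" if "CARD('d) = 1"
  proof -
    have "2 powr (1 / p) \<le> 2 powr 1" using assms by (intro powr_mono) auto
    then show ?thesis using r1 that by (simp add: K_def r_def le_divide_eq)
  qed
  have X: "1 + (2 ^ CARD('d) - 1) * c + 2 * ((2 ^ CARD('d) - 1) * K) * ((2 ^ CARD('d) - 1) * c) \<le> X"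
    unfolding X_def using r1 K2 by (intro greedy_constant_le c1) (auto simp: K_def)
  have "(1 :: real) < 2 ^ CARD('d)" by simp
  then have "0 < (2 ^ CARD('d) - 1) * c" using c1 by (intro mult_pos_pos) linarith+
  then have "0 < ((2 ^ CARD('d) - 1) * c)\<^sup>2" by (rule zero_less_power)
  moreover have "0 < 2 + K\<^sup>2" by (simp add: add_pos_nonneg)
  ultimately have X0: "0 < X" unfolding X_def by (rule mult_pos_pos[rotated])
  \<comment> \<open>Division by the positive \<open>X\<close> makes the left side a lower bound for
    every competitor, so it passes to the infimum. The greedy set itself is the index set of a
    competitor.\<close>
  have "Lp_norm p (\<lambda>x. g x - greedy_sum g \<Lambda> x) / X \<le> best_m_term p m g"
    unfolding best_m_term_def
  proof (rule cInf_greatest)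
    show "{Lp_norm p (\<lambda>x. g x - (\<Sum>I\<in>\<Lambda>. a I * haar I x)) | \<Lambda> a.
        \<Lambda> \<subseteq> haar_indices \<and> finite \<Lambda> \<and> card \<Lambda> = m} \<noteq> {}"
      using assms(4) by (auto simp: greedy_set_def simp del: haar.simps)
    fix y
    assume "y \<in> {Lp_norm p (\<lambda>x. g x - (\<Sum>I\<in>\<Lambda>. a I * haar I x)) | \<Lambda> a.
        \<Lambda> \<subseteq> haar_indices \<and> finite \<Lambda> \<and> card \<Lambda> = m}"
    then obtain P :: "'d haar_index set" and a where P: "P \<subseteq> haar_indices" "finite P" "card P = m"
      and y: "y = Lp_norm p (\<lambda>x. g x - (\<Sum>I\<in>P. a I * haar I x))" by blast
    have "Lp_norm p (\<lambda>x. g x - greedy_sum g \<Lambda> x)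
      \<le> (1 + (2 ^ CARD('d) - 1) * c + 2 * ((2 ^ CARD('d) - 1) * K) * ((2 ^ CARD('d) - 1) * c)) * y"
      unfolding y K_def by (rule greedy_error_le[OF assms P r_def]) (simp add: c_eq)
    also have "\<dots> \<le> X * y" using X by (rule mult_right_mono) (simp add: y)
    finally show "Lp_norm p (\<lambda>x. g x - greedy_sum g \<Lambda> x) / X \<le> y"
      using X0 by (simp add: divide_le_eq mult.commute)
  qed
  then show ?thesis
    using X0 unfolding K_eq c_def[symmetric] X_def[symmetric] by (simp add: divide_le_eq mult.commute)
qed

end
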